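(* Let $q>4$, and let $u_{a,\gamma,p}$ and $p(a)$ be as described in the context. There exist $\varepsilon>0$ and a unique function $\gamma=\gamma(a,p)\in C^\infty([0,\varepsilon)\times[3,q])$ with $$\gamma(0,4)=-\frac12,\qquad \gamma(a,p(a))=\frac{2}{p(a)}-1,$$ $$\frac{\partial\gamma}{\partial a}(0,4)=\frac18\,\frac{\|Q_4\|_{L^1}^2}{\|Q_4\|_{L^2}^2}=\frac18\,\frac{\Gamma(1/4)^4}{4\pi^2}\ \Big(\approx\frac18\cdot 4.3768\Big),\qquad \frac{\partial\gamma}{\partial p}(0,4)=0,$$ such that $x\mapsto u(x)=u_{a,\gamma(a,p),p}(x)$ is a solution to $$a\big((1+\gamma(a,p))u+xu_x\big)-\big(u_{xx}-u+|u|^pu\big)_x=0$$ with $$\partial_xu_{a,\gamma(a,p),p}\in L^2(\mathbb{R}),\qquad \sup_x\,(1+a|x|)^{1+\gamma(a,p)}\,|u_{a,\gamma(a,p),p}(x)|\le c$$ for some constant $c$. Moreover $u_{0,\gamma(0,p),p}=Q_p$.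
   Context: $Q_p(x)=\left(\frac{p+2}{2}\right)^{1/p}\operatorname{sech}^{2/p}\left(\frac{px}{2}\right)$ is the soliton, the even positive solution of $-Q''+Q-Q^{p+1}=0$; $\langle f,g\rangle=\int_{\mathbb{R}}fg\,dx$; $x_+=\max\{x,0\}$; $\Gamma(\cdot)$ is the Gamma function. The family $u_{a,\gamma,p}$: there is $\varepsilon_0>0$ and a unique map $(a,\gamma,p,x)\mapsto u_{a,\gamma,p}(x)$, smooth (up to $a=0$) on $0\le a<\varepsilon_0$, $|\gamma+\frac12|<\varepsilon_0$, $3\le p\le q$, $x\in\mathbb{R}$, such that (1) $u=u_{a,\gamma,p}$ solves $a((1+\gamma)u+xu_x)-u_{xxx}+u_x-(|u|^pu)_x+\langle Q_p',u\rangle Q_p''=0$; (2) $\sup_{a,\gamma,p,x}(1+a|x|)^{1+\gamma}|u_{a,\gamma,p}(x)|<\infty$; (3) $\sup_{a,\gamma,p,x}(1+x_+)^{1-k}|\partial_\gamma^n\partial_p^m\partial_a^ku_{a,\gamma,p}(x)|<\infty$ for all $k\ge1$, $n,m\ge0$; (4) $u_{0,\gamma,p}=Q_p$; (5) $u_{a,\gamma,p}>0$ and $\partial_xu_{a,\gamma,p}\in L^2(\mathbb{R})$; and $u_{a,\gamma,p}$ is the unique solution of the equation in (1) satisfying (2) and (5) in a small neighborhood of the soliton. The function $p(a)$: for small $a\ge0$, $a\mapsto p(a)$ is the unique smooth function with $p(0)=4$, $p'(0)=\|Q_4\|_{L^1}^2/\|Q_4\|_{L^2}^2$ such that $u=u_{a,\frac2{p(a)}-1,p(a)}$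 solves $a(\frac2{p}u+xu_x)-u_{xxx}+u_x-(|u|^pu)_x=0$ with $p=p(a)$.
   Formalization: The sign of ∂γ/∂a(0,4) is corrected to −(1/8)‖Q_4‖²_{L¹}/‖Q_4‖²_{L²}, as forced by γ(a,p(a))=2/p(a)−1 with ∂γ/∂p(0,4)=0; p ranges over the closed interval [3,q], also for uniqueness. *)

theory Defs
  imports "HOL-Analysis.Analysis"
begin

text \<open>
  C^k up to the boundary: one-sided Frechet derivatives relative to S, all continuous on S.
  For the sets used below (products of nondegenerate intervals) derivatives within S are
  unique, so this is the usual notion.
\<close>

primrec C_k_on :: "nat \<Rightarrow> 'a::euclidean_space set \<Rightarrow> ('a \<Rightarrow> real) \<Rightarrow> bool" where
  "C_k_on 0 S f \<longleftrightarrow> continuous_on S f"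
| "C_k_on (Suc k) S f \<longleftrightarrow>
     (\<exists>f'. (\<forall>x\<in>S. (f has_derivative f' x) (at x within S)) \<and>
           (\<forall>b\<in>Basis. C_k_on k S (\<lambda>x. f' x b)))"

definition smooth_on :: "'a::euclidean_space set \<Rightarrow> ('a \<Rightarrow> real) \<Rightarrow> bool" where
  "smooth_on S f \<longleftrightarrow> (\<forall>k. C_k_on k S f)"

definition nth_deriv_within :: "real set \<Rightarrow> nat \<Rightarrow> (real \<Rightarrow> real) \<Rightarrow> real \<Rightarrow> real" where
  "nth_deriv_within I n f = ((\<lambda>g t. vector_derivative g (at t within I)) ^^ n) f"

definition inner_L2 :: "(real \<Rightarrow> real) \<Rightarrow> (real \<Rightarrow> real) \<Rightarrow> real" where
  "inner_L2 f g = (\<integral>x. f x * g x \<partial>lborel)"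

definition L1_norm :: "(real \<Rightarrow> real) \<Rightarrow> real" where
  "L1_norm f = (\<integral>x. \<bar>f x\<bar> \<partial>lborel)"

definition L2_norm :: "(real \<Rightarrow> real) \<Rightarrow> real" where
  "L2_norm f = sqrt (\<integral>x. (f x)\<^sup>2 \<partial>lborel)"

definition in_L2 :: "(real \<Rightarrow> real) \<Rightarrow> bool" where
  "in_L2 f \<longleftrightarrow> f \<in> borel_measurable lborel \<and> integrable lborel (\<lambda>x. (f x)\<^sup>2)"

definition Q :: "real \<Rightarrow> real \<Rightarrow> real" where
  "Q p x = ((p + 2) / 2) powr (1 / p) * (1 / cosh (p * x / 2)) powr (2 / p)"

text \<open>
  \<open>a (b w + x w') - w''' + w' - (|w|^p w)'\<close>. It is only applied to functions that are
  smooth and positive by hypothesis, so that all the derivatives exist.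
\<close>

definition profile_op :: "real \<Rightarrow> real \<Rightarrow> real \<Rightarrow> (real \<Rightarrow> real) \<Rightarrow> real \<Rightarrow> real" where
  "profile_op a b p w x =
     a * (b * w x + x * deriv w x) - (deriv ^^ 3) w x + deriv w x
       - deriv (\<lambda>y. \<bar>w y\<bar> powr p * w y) x"

definition gamma_range :: "real \<Rightarrow> real set" where
  "gamma_range \<epsilon>0 = {\<gamma>. \<bar>\<gamma> + 1/2\<bar> < \<epsilon>0}"

text \<open>
  The family of profiles \<open>u a \<gamma> p x\<close> with \<open>0 \<le> a < \<epsilon>0\<close>, \<open>|\<gamma> + 1/2| < \<epsilon>0\<close>,
  \<open>3 \<le> p \<le> q\<close>. The finiteness of a supremum is stated as the existence of a bound.
\<close>

definition profile_family ::
    "real \<Rightarrow> real \<Rightarrow> (real \<Rightarrow> real \<Rightarrow> real \<Rightarrow> real \<Rightarrow> real) \<Rightarrow> bool" where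
  "profile_family \<epsilon>0 q u \<longleftrightarrow>
     smooth_on ({0..<\<epsilon>0} \<times> gamma_range \<epsilon>0 \<times> {3..q} \<times> UNIV) (\<lambda>(a, \<gamma>, p, x). u a \<gamma> p x) \<and>
     (\<forall>a\<in>{0..<\<epsilon>0}. \<forall>\<gamma>\<in>gamma_range \<epsilon>0. \<forall>p\<in>{3..q}. \<forall>x.
        profile_op a (1 + \<gamma>) p (u a \<gamma> p) x
          + inner_L2 (deriv (Q p)) (u a \<gamma> p) * (deriv ^^ 2) (Q p) x = 0) \<and>
     (\<exists>C. \<forall>a\<in>{0..<\<epsilon>0}. \<forall>\<gamma>\<in>gamma_range \<epsilon>0. \<forall>p\<in>{3..q}. \<forall>x.
        (1 + a * \<bar>x\<bar>) powr (1 + \<gamma>) * \<bar>u a \<gamma> p x\<bar> \<le> C) \<and>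
     (\<forall>k\<ge>1. \<forall>n m. \<exists>C. \<forall>a\<in>{0..<\<epsilon>0}. \<forall>\<gamma>\<in>gamma_range \<epsilon>0. \<forall>p\<in>{3..q}. \<forall>x.
        (1 + max x 0) powr (1 - real k) *
        \<bar>nth_deriv_within (gamma_range \<epsilon>0) n
           (\<lambda>\<gamma>'. nth_deriv_within {3..q} m
             (\<lambda>p'. nth_deriv_within {0..<\<epsilon>0} k (\<lambda>a'. u a' \<gamma>' p' x) a) p) \<gamma>\<bar> \<le> C) \<and>
     (\<forall>\<gamma>\<in>gamma_range \<epsilon>0. \<forall>p\<in>{3..q}. \<forall>x. u 0 \<gamma> p x = Q p x) \<and>
     (\<forall>a\<in>{0..<\<epsilon>0}. \<forall>\<gamma>\<in>gamma_range \<epsilon>0. \<forall>p\<in>{3..q}.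
        (\<forall>x. u a \<gamma> p x > 0) \<and> in_L2 (deriv (u a \<gamma> p)))"

definition unique_profile_family ::
    "real \<Rightarrow> real \<Rightarrow> (real \<Rightarrow> real \<Rightarrow> real \<Rightarrow> real \<Rightarrow> real) \<Rightarrow> bool" where
  "unique_profile_family \<epsilon>0 q u \<longleftrightarrow>
     profile_family \<epsilon>0 q u \<and>
     (\<forall>v. profile_family \<epsilon>0 q v \<longrightarrow>
        (\<forall>a\<in>{0..<\<epsilon>0}. \<forall>\<gamma>\<in>gamma_range \<epsilon>0. \<forall>p\<in>{3..q}. \<forall>x. v a \<gamma> p x = u a \<gamma> p x))"

text \<open>
  The curve \<open>a \<mapsto> P a\<close>, \<open>0 \<le> a < a0\<close>, of exponents with self-similar solutions of gKdV;
  membership in the ranges makes \<open>u a (2 / P a - 1) (P a)\<close> meaningful.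
\<close>

definition exponent_curve ::
    "real \<Rightarrow> real \<Rightarrow> (real \<Rightarrow> real \<Rightarrow> real \<Rightarrow> real \<Rightarrow> real) \<Rightarrow> real \<Rightarrow> (real \<Rightarrow> real) \<Rightarrow> bool" where
  "exponent_curve \<epsilon>0 q u a0 P \<longleftrightarrow>
     smooth_on {0..<a0} P \<and>
     P 0 = 4 \<and>
     (P has_real_derivative (L1_norm (Q 4))\<^sup>2 / (L2_norm (Q 4))\<^sup>2) (at 0 within {0..<a0}) \<and>
     (\<forall>a\<in>{0..<a0}. P a \<in> {3..q} \<and> 2 / P a - 1 \<in> gamma_range \<epsilon>0 \<and>
        (\<forall>x. profile_op a (2 / P a) (P a) (u a (2 / P a - 1) (P a)) x = 0))"

definition unique_exponent_curve ::
    "real \<Rightarrow> real \<Rightarrow> (real \<Rightarrow> real \<Rightarrow> real \<Rightarrow> real \<Rightarrow> real) \<Rightarrow> real \<Rightarrow> (real \<Rightarrow> real) \<Rightarrow> bool" where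
  "unique_exponent_curve \<epsilon>0 q u a0 P \<longleftrightarrow>
     exponent_curve \<epsilon>0 q u a0 P \<and>
     (\<forall>P'. exponent_curve \<epsilon>0 q u a0 P' \<longrightarrow> (\<forall>a\<in>{0..<a0}. P' a = P a))"

text \<open>
  The properties required of \<open>\<gamma>\<close> on \<open>[0,\<epsilon>) \<times> [3,q]\<close>. The minus sign in the \<open>a\<close>-derivative
  is forced: differentiating \<open>\<gamma>(a, P a) = 2 / P a - 1\<close> at \<open>a = 0\<close>, where \<open>P 0 = 4\<close> and
  \<open>\<partial>\<gamma>/\<partial>p = 0\<close>, gives \<open>\<partial>\<gamma>/\<partial>a (0,4) = - P'(0) / 8\<close>.
\<close>

definition gamma_branch ::
    "real \<Rightarrow> real \<Rightarrow> (real \<Rightarrow> real \<Rightarrow> real \<Rightarrow> real \<Rightarrow> real) \<Rightarrow> (real \<Rightarrow> real) \<Rightarrow>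
     real \<Rightarrow> (real \<Rightarrow> real \<Rightarrow> real) \<Rightarrow> bool" where
  "gamma_branch \<epsilon>0 q u P \<epsilon> \<gamma> \<longleftrightarrow>
     smooth_on ({0..<\<epsilon>} \<times> {3..q}) (\<lambda>(a, p). \<gamma> a p) \<and>
     (\<forall>a\<in>{0..<\<epsilon>}. \<forall>p\<in>{3..q}. \<gamma> a p \<in> gamma_range \<epsilon>0) \<and>
     \<gamma> 0 4 = - 1/2 \<and>
     (\<forall>a\<in>{0..<\<epsilon>}. \<gamma> a (P a) = 2 / P a - 1) \<and>
     ((\<lambda>a. \<gamma> a 4) has_real_derivative - (1/8 * ((L1_norm (Q 4))\<^sup>2 / (L2_norm (Q 4))\<^sup>2)))
       (at 0 within {0..<\<epsilon>}) \<and>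
     ((\<lambda>p. \<gamma> 0 p) has_real_derivative 0) (at 4) \<and>
     (\<forall>a\<in>{0..<\<epsilon>}. \<forall>p\<in>{3..q}. \<forall>x.
        a * ((1 + \<gamma> a p) * u a (\<gamma> a p) p x + x * deriv (u a (\<gamma> a p) p) x)
          - deriv (\<lambda>y. (deriv ^^ 2) (u a (\<gamma> a p) p) y - u a (\<gamma> a p) p y
                        + \<bar>u a (\<gamma> a p) p y\<bar> powr p * u a (\<gamma> a p) p y) x = 0) \<and>
     (\<forall>a\<in>{0..<\<epsilon>}. \<forall>p\<in>{3..q}. in_L2 (deriv (u a (\<gamma> a p) p))) \<and>
     (\<exists>c. \<forall>a\<in>{0..<\<epsilon>}. \<forall>p\<in>{3..q}. \<forall>x.
        (1 + a * \<bar>x\<bar>) powr (1 + \<gamma> a p) * \<bar>u a (\<gamma> a p) p x\<bar> \<le> c)"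

end

theory Submission
  imports Defs
begin

text \<open>
  The profile \<open>u\<close> with parameters \<open>(a, \<gamma>, p)\<close> solves the self-similar equation up to the term
  \<open>F * Q''\<close>, where \<open>F = \<langle>Q', u\<rangle>\<close> depends on the parameters only. So the branch sought is the zero
  set of one scalar function of \<open>(a, \<gamma>, p)\<close>. Evaluating the equation at \<open>x = 0\<close>, where
  \<open>Q'' = - (p / 2) * Q\<close> is not zero, replaces \<open>F\<close> by the function \<open>\<Phi>\<close>, which is
  \<open>F\<close> up to a positive factor and which involves \<open>u\<close> and its derivatives at one point only;
  it inherits the smoothness of the family up to \<open>a = 0\<close> (\<open>smooth_on_\<Phi>\<close>).

  At \<open>a = 0\<close> the profile is the soliton and \<open>\<Phi>\<close> vanishes identically, so the zeros have to be found
  after division by \<open>a\<close>. By Hadamard's lemma (\<open>smooth_on_divide_boundary_coordinate\<close>),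
  \<open>\<Phi> = a * G\<close> with \<open>G\<close> smooth up to the boundary. Testing the equation with \<open>Q\<close>
  (\<open>soliton_projection\<close>) gives
  \<open>F * \<parallel>Q'\<parallel>\<^sup>2 = a * (\<gamma> + 1/2) * \<parallel>Q\<parallel>\<^sup>2 + O(a\<^sup>2)\<close>, because \<open>u - Q = O(a)\<close> and
  \<open>Q'\<close> is annihilated by the linearisation at \<open>Q\<close>. Therefore \<open>G = \<kappa> p * (\<gamma> + 1/2)\<close> with
  \<open>\<kappa> p > 0\<close> on the face \<open>a = 0\<close> (\<open>reduced_function\<close>).

  The implicit function theorem, applied up to the boundary and uniformly in the compact range of
  \<open>p\<close>, yields one smooth zero \<open>\<gamma>\<close> of \<open>G\<close> close to \<open>- 1/2\<close> for each \<open>(a, p)\<close>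
  (\<open>smooth_zero_branch\<close>), with \<open>\<gamma> = - 1/2\<close> for \<open>a = 0\<close>. A continuous path of zeros that starts at
  \<open>- 1/2\<close> cannot leave the region where the zero is unique. This single observation gives the
  uniqueness of \<open>\<gamma>\<close>, applied to a competing branch with \<open>p\<close> fixed, and the identity
  \<open>\<gamma> (a, P a) = 2 / P a - 1\<close>, applied to the curve of exponents. Differentiating that identity at
  \<open>a = 0\<close> gives \<open>\<partial>\<gamma>/\<partial>a\<close>, since \<open>\<gamma>\<close> is constant on the face. The
  numerical value reduces to Beta integrals by a logistic substitution
  (\<open>lborel_integral_sech_powr\<close>).
\<close>

section \<open>Calculus of functions that are smooth up to the boundary\<close>

lemma C_k_on_cong:
  assumes "\<And>x. x \<in> S \<Longrightarrow> f x = g x"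
  shows "C_k_on k S f \<longleftrightarrow> C_k_on k S g"
proof (cases k)
  case 0
  then show ?thesis using assms by (simp cong: continuous_on_cong)
next
  case (Suc n)
  have "(f has_derivative D) (at x within S) \<longleftrightarrow> (g has_derivative D) (at x within S)"
    if "x \<in> S" for x D
    using assms that has_derivative_transform[of x S f g D] has_derivative_transform[of x S g f D]
    by auto
  then show ?thesis unfolding Suc by simp
qed

lemma C_k_on_Suc_imp: "C_k_on (Suc k) S f \<Longrightarrow> C_k_on k S f"
proof (induction k arbitrary: f)
  case 0
  then show ?case
    by (auto intro: has_derivative_continuous simp: continuous_on_eq_continuous_within)
next
  case (Suc k)
  then obtain f' where "\<forall>x\<in>S. (f has_derivative f' x) (at x within S)"
      "\<forall>b\<in>Basis. C_k_on (Suc k) S (\<lambda>x. f' x b)" by auto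
  with Suc.IH show ?case by (metis C_k_on.simps(2))
qed

lemma C_k_on_continuous: "C_k_on k S f \<Longrightarrow> continuous_on S f"
  by (induction k) (simp, metis C_k_on_Suc_imp C_k_on.simps(1))

lemma C_k_on_subset: "C_k_on k T f \<Longrightarrow> S \<subseteq> T \<Longrightarrow> C_k_on k S f"
proof (induction k arbitrary: f)
  case 0
  then show ?case by (auto intro: continuous_on_subset)
next
  case (Suc k)
  then obtain f' where "\<forall>x\<in>T. (f has_derivative f' x) (at x within T)"
      "\<forall>b\<in>Basis. C_k_on k T (\<lambda>x. f' x b)" by auto
  then show ?case using Suc.IH Suc.prems(2)
    by (auto intro!: exI[of _ f'] intro: has_derivative_subset)
qed

lemma C_k_on_const: "C_k_on k S (\<lambda>x. c)"
proof (induction k arbitrary: c)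
  case (Suc k)
  show ?case by (auto intro!: exI[of _ "\<lambda>_ _. 0"] Suc)
qed simp

lemma C_k_on_bounded_linear: "bounded_linear f \<Longrightarrow> C_k_on k S f"
  by (cases k) (auto intro!: linear_continuous_on exI[of _ "\<lambda>_. f"] bounded_linear_imp_has_derivative
      C_k_on_const)

lemma C_k_on_add: "C_k_on k S f \<Longrightarrow> C_k_on k S g \<Longrightarrow> C_k_on k S (\<lambda>x. f x + g x)"
proof (induction k arbitrary: f g)
  case 0
  then show ?case by (auto intro: continuous_intros)
next
  case (Suc k)
  then obtain f' g' where
    "\<forall>x\<in>S. (f has_derivative f' x) (at x within S)" "\<forall>b\<in>Basis. C_k_on k S (\<lambda>x. f' x b)"
    "\<forall>x\<in>S. (g has_derivative g' x) (at x within S)" "\<forall>b\<in>Basis. C_k_on k S (\<lambda>x. g' x b)"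
    by auto
  then show ?case using Suc.IH
    by (auto intro!: exI[of _ "\<lambda>x h. f' x h + g' x h"] has_derivative_add)
qed

lemma C_k_on_mult: "C_k_on k S f \<Longrightarrow> C_k_on k S g \<Longrightarrow> C_k_on k S (\<lambda>x. f x * g x)"
proof (induction k arbitrary: f g)
  case 0
  then show ?case by (auto intro: continuous_intros)
next
  case (Suc k)
  then obtain f' g' where
    "\<forall>x\<in>S. (f has_derivative f' x) (at x within S)" "\<forall>b\<in>Basis. C_k_on k S (\<lambda>x. f' x b)"
    "\<forall>x\<in>S. (g has_derivative g' x) (at x within S)" "\<forall>b\<in>Basis. C_k_on k S (\<lambda>x. g' x b)"
    by auto
  moreover have "C_k_on k S f" "C_k_on k S g" using Suc.prems C_k_on_Suc_imp by blast+
  ultimately show ?case using Suc.IH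
    by (auto intro!: exI[of _ "\<lambda>x h. f x * g' x h + f' x h * g x"] has_derivative_mult C_k_on_add)
qed

lemma C_k_on_minus: "C_k_on k S f \<Longrightarrow> C_k_on k S (\<lambda>x. - f x)"
  using C_k_on_mult[OF C_k_on_const[of k S "-1"]] by simp

lemma C_k_on_diff: "C_k_on k S f \<Longrightarrow> C_k_on k S g \<Longrightarrow> C_k_on k S (\<lambda>x. f x - g x)"
  using C_k_on_add[OF _ C_k_on_minus] by simp

lemma C_k_on_sum: "(\<And>i. i \<in> I \<Longrightarrow> C_k_on k S (f i)) \<Longrightarrow> C_k_on k S (\<lambda>x. \<Sum>i\<in>I. f i x)"
  by (induction I rule: infinite_finite_induct) (auto intro: C_k_on_add C_k_on_const)

lemma C_k_on_inverse:
  assumes "\<And>x. x \<in> S \<Longrightarrow> f x \<noteq> 0"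
  shows "C_k_on k S f \<Longrightarrow> C_k_on k S (\<lambda>x. inverse (f x))"
proof (induction k)
  case 0
  then show ?case using assms by (auto intro: continuous_intros)
next
  case (Suc k)
  then obtain f' where
    f': "\<forall>x\<in>S. (f has_derivative f' x) (at x within S)" "\<forall>b\<in>Basis. C_k_on k S (\<lambda>x. f' x b)"
    by auto
  have inv: "C_k_on k S (\<lambda>x. inverse (f x))" using Suc C_k_on_Suc_imp by blast
  show ?case using f' assms
    by (auto intro!: exI[of _ "\<lambda>x h. - (inverse (f x) * f' x h * inverse (f x))"]
        has_derivative_inverse C_k_on_minus C_k_on_mult inv)
qed

lemma C_k_on_ln:
  assumes "\<And>x. x \<in> S \<Longrightarrow> f x > 0" and "C_k_on k S f"
  shows "C_k_on k S (\<lambda>x. ln (f x))"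
proof (cases k)
  case 0
  have "f x \<noteq> 0" if "x \<in> S" for x using assms(1)[OF that] by simp
  then show ?thesis using assms 0 by (auto intro!: continuous_intros)
next
  case (Suc n)
  then obtain f' where
    f': "\<forall>x\<in>S. (f has_derivative f' x) (at x within S)" "\<forall>b\<in>Basis. C_k_on n S (\<lambda>x. f' x b)"
    using assms by auto
  have inv: "C_k_on n S (\<lambda>x. inverse (f x))"
    using assms(1) C_k_on_Suc_imp[of n S f] assms(2)[unfolded Suc] by (intro C_k_on_inverse) force+
  have "((\<lambda>x. ln (f x)) has_derivative (\<lambda>h. f' x h * inverse (f x))) (at x within S)"
    if "x \<in> S" for x
    using has_derivative_ln[of f x "f' x" S] assms(1)[OF that] f' that by blast
  then show ?thesis using f' inv unfolding Suc
    by (auto intro!: exI[of _ "\<lambda>x h. f' x h * inverse (f x)"] C_k_on_mult)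
qed

lemma C_k_on_exp: "C_k_on k S f \<Longrightarrow> C_k_on k S (\<lambda>x. exp (f x))"
proof (induction k)
  case 0
  then show ?case by (auto intro: continuous_intros)
next
  case (Suc k)
  then obtain f' where
    f': "\<forall>x\<in>S. (f has_derivative f' x) (at x within S)" "\<forall>b\<in>Basis. C_k_on k S (\<lambda>x. f' x b)"
    by auto
  have e: "C_k_on k S (\<lambda>x. exp (f x))" using Suc C_k_on_Suc_imp by blast
  have "((\<lambda>x. exp (f x)) has_derivative (\<lambda>h. f' x h * exp (f x))) (at x within S)"
    if "x \<in> S" for x
    by (rule has_derivative_eq_rhs, rule has_derivative_exp) (use f' that in auto)
  then show ?case using f' e
    by (auto intro!: exI[of _ "\<lambda>x h. f' x h * exp (f x)"] C_k_on_mult)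
qed

lemma C_k_on_powr:
  assumes "\<And>x. x \<in> S \<Longrightarrow> f x > 0" "C_k_on k S f" "C_k_on k S g"
  shows "C_k_on k S (\<lambda>x. f x powr g x)"
proof -
  have "C_k_on k S (\<lambda>x. exp (g x * ln (f x)))"
    by (intro C_k_on_exp C_k_on_mult C_k_on_ln assms)
  also have "?this \<longleftrightarrow> ?thesis"
    using assms(1) by (intro C_k_on_cong) (force simp: powr_def)
  finally show ?thesis .
qed

text \<open>
  The derivative of a composition is a sum over the basis of products of partial derivatives, so
  the induction on the order of differentiability needs only products and sums.
\<close>

lemma C_k_on_compose:
  fixes g :: "'a::euclidean_space \<Rightarrow> 'b::euclidean_space"
  assumes "g ` S \<subseteq> T" and "C_k_on k T f" and "\<And>c. c \<in> Basis \<Longrightarrow> C_k_on k S (\<lambda>x. g x \<bullet> c)"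
  shows "C_k_on k S (\<lambda>x. f (g x))"
  using assms(2,3)
proof (induction k arbitrary: f)
  case 0
  then have "continuous_on S g" by (intro continuous_on_componentwise[THEN iffD2]) auto
  with 0 assms(1) show ?case by (auto intro: continuous_on_compose2)
next
  case (Suc k)
  then obtain f' where
    f': "\<And>x. x\<in>T \<Longrightarrow> (f has_derivative f' x) (at x within T)" "\<forall>b\<in>Basis. C_k_on k T (\<lambda>x. f' x b)"
    by (metis C_k_on.simps(2))
  from Suc.prems(2) have "\<forall>c\<in>Basis. \<exists>g'. (\<forall>x\<in>S. ((\<lambda>x. g x \<bullet> c) has_derivative g' x) (at x within S)) \<and>
       (\<forall>b\<in>Basis. C_k_on k S (\<lambda>x. g' x b))" by simp
  then obtain g' where
    g': "\<And>c x. c \<in> Basis \<Longrightarrow> x \<in> S \<Longrightarrow> ((\<lambda>x. g x \<bullet> c) has_derivative g' c x) (at x within S)"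
      "\<And>c b. c \<in> Basis \<Longrightarrow> b \<in> Basis \<Longrightarrow> C_k_on k S (\<lambda>x. g' c x b)" by metis
  have "(g has_derivative (\<lambda>h. \<Sum>c\<in>Basis. g' c x h *\<^sub>R c)) (at x within S)" if "x \<in> S" for x
    unfolding has_derivative_componentwise_within[of g]
    using g'(1)[OF _ that] by simp
  note D = has_derivative_in_compose2[OF f'(1) assms(1) _ this]
  have D': "((\<lambda>x. f (g x)) has_derivative (\<lambda>h. \<Sum>c\<in>Basis. g' c x h * f' (g x) c)) (at x within S)"
    if "x \<in> S" for x
  proof -
    have "linear (f' (g x))" using f'(1)[of "g x"] that assms(1) has_derivative_linear by blast
    with D[OF _ that that] show ?thesis by (simp add: linear_sum linear_scale)
  qed
  have "C_k_on k S (\<lambda>x. \<Sum>c\<in>Basis. g' c x b * f' (g x) c)" if "b \<in> Basis" for b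
    using Suc.IH[OF _ C_k_on_Suc_imp[OF Suc.prems(2)]] f'(2) g'(2) that
    by (intro C_k_on_sum C_k_on_mult) auto
  with D' show ?case by (auto intro!: exI[of _ "\<lambda>x h. \<Sum>c\<in>Basis. g' c x h * f' (g x) c"])
qed

lemma smooth_on_cong: "(\<And>x. x \<in> S \<Longrightarrow> f x = g x) \<Longrightarrow> smooth_on S f \<longleftrightarrow> smooth_on S g"
  unfolding smooth_on_def using C_k_on_cong by blast

lemma smooth_on_continuous: "smooth_on S f \<Longrightarrow> continuous_on S f"
  unfolding smooth_on_def by (blast intro: C_k_on_continuous)

lemma smooth_on_subset: "smooth_on T f \<Longrightarrow> S \<subseteq> T \<Longrightarrow> smooth_on S f"
  unfolding smooth_on_def by (blast intro: C_k_on_subset)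

lemma smooth_on_const: "smooth_on S (\<lambda>x. c)"
  unfolding smooth_on_def by (blast intro: C_k_on_const)

lemma smooth_on_bounded_linear: "bounded_linear f \<Longrightarrow> smooth_on S f"
  unfolding smooth_on_def by (blast intro: C_k_on_bounded_linear)

lemma smooth_on_add: "smooth_on S f \<Longrightarrow> smooth_on S g \<Longrightarrow> smooth_on S (\<lambda>x. f x + g x)"
  unfolding smooth_on_def by (blast intro: C_k_on_add)

lemma smooth_on_diff: "smooth_on S f \<Longrightarrow> smooth_on S g \<Longrightarrow> smooth_on S (\<lambda>x. f x - g x)"
  unfolding smooth_on_def by (blast intro: C_k_on_diff)

lemma smooth_on_mult: "smooth_on S f \<Longrightarrow> smooth_on S g \<Longrightarrow> smooth_on S (\<lambda>x. f x * g x)"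
  unfolding smooth_on_def by (blast intro: C_k_on_mult)

lemma smooth_on_powr:
  "(\<And>x. x \<in> S \<Longrightarrow> f x > 0) \<Longrightarrow> smooth_on S f \<Longrightarrow> smooth_on S g \<Longrightarrow> smooth_on S (\<lambda>x. f x powr g x)"
  unfolding smooth_on_def by (blast intro: C_k_on_powr)

lemma smooth_on_compose:
  fixes g :: "'a::euclidean_space \<Rightarrow> 'b::euclidean_space"
  assumes "smooth_on T f" "g ` S \<subseteq> T" "\<And>c. c \<in> Basis \<Longrightarrow> smooth_on S (\<lambda>x. g x \<bullet> c)"
  shows "smooth_on S (\<lambda>x. f (g x))"
  using assms unfolding smooth_on_def by (blast intro: C_k_on_compose)

text \<open>
  Every point can be approached inside the set along each coordinate direction, on at least one
  side. This is what makes derivatives relative to the set unique, corners included.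
\<close>

definition coordinate_perfect :: "'a::euclidean_space set \<Rightarrow> bool" where
  "coordinate_perfect S \<longleftrightarrow>
     (\<forall>x\<in>S. \<forall>b\<in>Basis. \<forall>e>0. \<exists>d. 0 < \<bar>d\<bar> \<and> \<bar>d\<bar> < e \<and> x + d *\<^sub>R b \<in> S)"

lemma coordinate_perfect_Times:
  assumes "coordinate_perfect S" "coordinate_perfect T"
  shows "coordinate_perfect (S \<times> T)"
  using assms unfolding coordinate_perfect_def
  by (force simp: Basis_prod_def)

lemma coordinate_perfect_interval:
  fixes S :: "real set"
  assumes "is_interval S" "x1 \<in> S" "x2 \<in> S" "x1 \<noteq> x2"
  shows "coordinate_perfect S"
  unfolding coordinate_perfect_def
proof (intro ballI allI impI)
  fix x b e :: real
  assume "x \<in> S" "b \<in> Basis" "e > 0"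
  obtain y where y: "y \<in> S" "y \<noteq> x" using assms by metis
  define d where "d = min 1 (e / (2 * \<bar>y - x\<bar>)) * (y - x)"
  have "0 < \<bar>d\<bar>" using y \<open>e > 0\<close> by (auto simp: d_def abs_mult)
  moreover have "\<bar>d\<bar> < e"
  proof -
    have "\<bar>d\<bar> \<le> (e / (2 * \<bar>y - x\<bar>)) * \<bar>y - x\<bar>"
      unfolding d_def abs_mult using \<open>e > 0\<close> y by (intro mult_right_mono) (auto simp: min_def)
    also have "\<dots> = e / 2" using y by simp
    finally show ?thesis using \<open>e > 0\<close> by linarith
  qed
  moreover have "x + d *\<^sub>R b \<in> S"
  proof -
    have "convex S" using assms(1) by (simp add: is_interval_convex)
    moreover have "0 \<le> min 1 (e / (2 * \<bar>y - x\<bar>))" using \<open>e > 0\<close> by simp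
    ultimately have "(1 - min 1 (e / (2 * \<bar>y - x\<bar>))) *\<^sub>R x + min 1 (e / (2 * \<bar>y - x\<bar>)) *\<^sub>R y \<in> S"
      using \<open>x \<in> S\<close> y by (intro convexD_alt) auto
    then show ?thesis using \<open>b \<in> Basis\<close> by (simp add: d_def algebra_simps)
  qed
  ultimately show "\<exists>d. 0 < \<bar>d\<bar> \<and> \<bar>d\<bar> < e \<and> x + d *\<^sub>R b \<in> S" by blast
qed

lemma smooth_on_has_derivative:
  assumes "smooth_on S f" "x \<in> S"
  shows "(f has_derivative frechet_derivative f (at x within S)) (at x within S)"
proof -
  have "C_k_on (Suc 0) S f" using assms unfolding smooth_on_def by blast
  then show ?thesis using assms(2) frechet_derivative_works unfolding C_k_on.simps differentiable_def
    by blast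
qed

text \<open>
  The definition of differentiability of order \<open>k\<close> offers some derivative for each \<open>k\<close>. On a set
  where derivatives are unique these agree, so that a partial derivative of a smooth function is
  again smooth.
\<close>

lemma smooth_on_partial:
  assumes "smooth_on S f" "coordinate_perfect S" "b \<in> Basis"
  shows "smooth_on S (\<lambda>x. frechet_derivative f (at x within S) b)"
  unfolding smooth_on_def
proof
  fix k
  have "C_k_on (Suc k) S f" using assms unfolding smooth_on_def by blast
  then obtain f' where f': "\<And>x. x\<in>S \<Longrightarrow> (f has_derivative f' x) (at x within S)"
    "\<forall>b\<in>Basis. C_k_on k S (\<lambda>x. f' x b)" by auto
  have eq: "f' x = frechet_derivative f (at x within S)" if "x \<in> S" for x
    by (rule frechet_derivative_unique_within[OF f'(1)[OF that] smooth_on_has_derivative[OF assms(1) that]])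
       (use assms(2) that in \<open>auto simp: coordinate_perfect_def\<close>)
  have "C_k_on k S (\<lambda>x. f' x b)" using f' assms by blast
  also have "?this \<longleftrightarrow> C_k_on k S (\<lambda>x. frechet_derivative f (at x within S) b)"
    by (rule C_k_on_cong) (simp add: eq)
  finally show "C_k_on k S (\<lambda>x. frechet_derivative f (at x within S) b)" .
qed

lemma bounded_linear_euclideanI:
  fixes f :: "'a::euclidean_space \<Rightarrow> 'b::real_normed_vector"
  assumes "\<And>x y. f (x + y) = f x + f y" "\<And>r x. f (r *\<^sub>R x) = r *\<^sub>R f x"
  shows "bounded_linear f"
  using assms by (intro linear_conv_bounded_linear[THEN iffD1] linearI)

lemma smooth_on_compose_linear:
  fixes g :: "'a::euclidean_space \<Rightarrow> 'b::euclidean_space"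
  assumes "smooth_on T f" "bounded_linear g" "g ` S \<subseteq> T"
  shows "smooth_on S (\<lambda>x. f (g x))"
  by (rule smooth_on_compose[OF assms(1,3)])
     (rule smooth_on_bounded_linear[OF bounded_linear_compose[OF bounded_linear_inner_left assms(2)]])

lemma frechet_derivative_within_subset:
  assumes "smooth_on T f" "S \<subseteq> T" "coordinate_perfect S" "x \<in> S"
  shows "frechet_derivative f (at x within S) = frechet_derivative f (at x within T)"
proof (rule frechet_derivative_unique_within[of f _ x S])
  show "(f has_derivative frechet_derivative f (at x within S)) (at x within S)"
    using smooth_on_has_derivative[OF smooth_on_subset[OF assms(1,2)] assms(4)] .
  show "(f has_derivative frechet_derivative f (at x within T)) (at x within S)"
    using smooth_on_has_derivative[OF assms(1), of x] assms has_derivative_subset by blast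
qed (use assms in \<open>auto simp: coordinate_perfect_def\<close>)

lemma has_derivative_unique_coordinate_perfect:
  assumes "(f has_derivative f') (at x within S)" "(f has_derivative f'') (at x within S)"
    "coordinate_perfect S" "x \<in> S"
  shows "f' = f''"
  by (rule frechet_derivative_unique_within[OF assms(1,2)])
     (use assms(3,4) in \<open>auto simp: coordinate_perfect_def\<close>)

section \<open>Division by a boundary coordinate and implicit functions\<close>

text \<open>
  Differentiation in the first coordinate brings out one more factor \<open>t\<close>, in the other coordinates
  none. Allowing the weights \<open>t ^ j\<close> therefore closes the induction on \<open>k\<close>.
\<close>

lemma C_k_on_ray_average:
  fixes f :: "real \<times> 'b::euclidean_space \<Rightarrow> real"
  assumes "convex T" "C_k_on k ({0..<e} \<times> T) f"
  shows "C_k_on k ({0..<e} \<times> T) (\<lambda>z. integral {0..1} (\<lambda>t. t ^ j * f (t * fst z, snd z)))"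
  using assms(2)
proof (induction k arbitrary: f j)
  let ?S = "{0..<e} \<times> T"
  have ray: "(t * fst z, snd z) \<in> ?S" if z: "z \<in> ?S" and t: "t \<in> {0..1}" for z t
  proof -
    obtain a w where aw: "z = (a, w)" "a \<in> {0..<e}" "w \<in> T" using z by blast
    have "t * a \<le> a" "0 \<le> t * a" using aw t by (auto intro!: mult_left_le_one_le)
    moreover have "a < e" using aw by simp
    ultimately have "t * a \<in> {0..<e}" unfolding atLeastLessThan_iff by linarith
    with aw show ?thesis by simp
  qed
  have cont: "continuous_on (?S \<times> cbox 0 1) (\<lambda>(z, t). t ^ j * g (t * fst z, snd z))"
    if "continuous_on ?S g" for g :: "real \<times> 'b \<Rightarrow> real" and j
  proof -
    have "continuous_on (?S \<times> cbox 0 1) (\<lambda>y. g (snd y * fst (fst y), snd (fst y)))"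
    proof (rule continuous_on_compose2[OF that])
      show "(\<lambda>y. (snd y * fst (fst y), snd (fst y))) ` (?S \<times> cbox 0 1) \<subseteq> ?S"
      proof
        fix p assume "p \<in> (\<lambda>y. (snd y * fst (fst y), snd (fst y))) ` (?S \<times> cbox 0 1)"
        then obtain y where y: "y \<in> ?S \<times> cbox 0 1" "p = (snd y * fst (fst y), snd (fst y))" by blast
        then have "fst y \<in> ?S" "snd y \<in> {0..1}" using iffD1[OF mem_Times_iff y(1)] by (simp_all only: cbox_interval)
        from ray[OF this] y(2) show "p \<in> ?S" by simp
      qed
    qed (intro continuous_on_Pair continuous_on_mult continuous_on_fst continuous_on_snd continuous_on_id)
    moreover have "continuous_on (?S \<times> cbox 0 1) (\<lambda>y. snd y ^ j :: real)"
      by (intro continuous_on_power continuous_on_snd continuous_on_id)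
    ultimately show ?thesis unfolding case_prod_beta by (rule continuous_on_mult[rotated])
  qed
  {
    case 0
    then have "continuous_on ?S f" by simp
    from integral_continuous_on_param[where f = "\<lambda>z t. t ^ j * f (t * fst z, snd z)", OF cont[OF this, of j]]
    show ?case by (simp only: C_k_on.simps cbox_interval)
  next
    case (Suc k)
    then obtain f' where
      f': "\<And>x. x\<in>?S \<Longrightarrow> (f has_derivative f' x) (at x within ?S)"
        "\<And>b. b\<in>Basis \<Longrightarrow> C_k_on k ?S (\<lambda>x. f' x b)"
      using Suc.prems unfolding C_k_on.simps by blast
    define h where "h z t v = t ^ j * f' (t * fst z, snd z) (t * fst v, snd v)" for z v :: "real \<times> 'b" and t :: real
    have lin: "linear (f' x)" if "x \<in> ?S" for x by (rule has_derivative_linear[OF f'(1)[OF that]])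
    have dh: "((\<lambda>z. t ^ j * f (t * fst z, snd z)) has_derivative h z t) (at z within ?S)"
      if "z \<in> ?S" "t \<in> cbox 0 1" for z t
      unfolding h_def
    proof (rule has_derivative_mult_right, rule has_derivative_in_compose2[OF f'(1)])
      show "(\<lambda>z. (t * fst z, snd z)) ` ?S \<subseteq> ?S"
        by (intro image_subsetI ray) (use that(2) in \<open>simp_all only: cbox_interval\<close>)
      show "((\<lambda>z. (t * fst z, snd z)) has_derivative (\<lambda>v. (t * fst v, snd v))) (at z within ?S)"
        by (auto intro!: derivative_eq_intros)
    qed (use that in auto)
    define H where "H z t = Blinfun (h z t)" for z t
    have H: "blinfun_apply (H z t) = h z t" if "z \<in> ?S" "t \<in> cbox 0 1" for z t
      unfolding H_def by (rule bounded_linear_Blinfun_apply[OF has_derivative_bounded_linear[OF dh[OF that]]])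
    have h_basis: "h z t b = t ^ (if fst b = 0 then j else Suc j) * f' (t * fst z, snd z) b"
      if "b \<in> Basis" "z \<in> ?S" "t \<in> {0..1}" for z t b
    proof -
      have "(t * fst b, snd b) = (if fst b = 0 then b else t *\<^sub>R b)"
        using that(1) by (auto simp: Basis_prod_def)
      then show ?thesis using linear_scale[OF lin[OF ray[OF that(2,3)]], of t b] by (simp add: h_def)
    qed
    have "continuous_on (?S \<times> cbox 0 1) (\<lambda>x. blinfun_apply (case x of (z, t) \<Rightarrow> H z t) b)" if b: "b \<in> Basis" for b
    proof -
      have "continuous_on (?S \<times> cbox 0 1)
         (\<lambda>(z, t). t ^ (if fst b = 0 then j else Suc j) * f' (t * fst z, snd z) b)"
        by (rule cont[OF C_k_on_continuous[OF f'(2)[OF b]]])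
      then show ?thesis
      proof (rule continuous_on_eq)
        fix x assume "x \<in> ?S \<times> cbox 0 (1::real)"
        then obtain z t where x: "x = (z, t)" "z \<in> ?S" "t \<in> cbox 0 1" by blast
        show "(case x of (z, t) \<Rightarrow> t ^ (if fst b = 0 then j else Suc j) * f' (t * fst z, snd z) b) =
            blinfun_apply (case x of (z, t) \<Rightarrow> H z t) b"
          using h_basis[OF b x(2), of t] H[OF x(2,3)] x(3) unfolding x(1) by simp
      qed
    qed
    then have contH: "continuous_on (?S \<times> cbox 0 1) (\<lambda>(z, t). H z t)"
      by (rule continuous_on_blinfun_componentwise)
    have intb: "(\<lambda>t. t ^ j * f (t * fst z, snd z)) integrable_on cbox 0 1" if "z \<in> ?S" for z
    proof -
      have "continuous_on (cbox 0 1) (\<lambda>t. (case (z, t) of (z, t) \<Rightarrow> t ^ j * f (t * fst z, snd z)))"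
        by (rule continuous_on_compose2[OF cont[OF C_k_on_continuous[OF Suc.prems], of j]])
           (use that in \<open>auto intro!: continuous_intros\<close>)
      then show ?thesis by (intro integrable_continuous) simp
    qed
    have intH: "H z integrable_on cbox 0 1" if "z \<in> ?S" for z
    proof -
      have "continuous_on (cbox 0 1) (\<lambda>t. (case (z, t) of (z, t) \<Rightarrow> H z t))"
        by (rule continuous_on_compose2[OF contH]) (use that in \<open>auto intro!: continuous_intros\<close>)
      then show ?thesis by (intro integrable_continuous) simp
    qed
    have "((\<lambda>z. integral (cbox 0 1) (\<lambda>t. t ^ j * f (t * fst z, snd z))) has_derivative
            integral (cbox 0 1) (H z)) (at z within ?S)" if "z \<in> ?S" for z
    proof (rule leibniz_rule[where f = "\<lambda>z t. t ^ j * f (t * fst z, snd z)" and fx = H])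
      show "((\<lambda>z. t ^ j * f (t * fst z, snd z)) has_derivative blinfun_apply (H z t)) (at z within ?S)"
        if "z \<in> ?S" "t \<in> cbox 0 1" for z t using dh[OF that] H[OF that] by simp
      show "convex ?S" using assms(1) by (intro convex_Times convex_real_interval)
    qed (fact contH intb that)+
    moreover have "C_k_on k ?S (\<lambda>z. blinfun_apply (integral (cbox 0 1) (H z)) b)" if b: "b \<in> Basis" for b
    proof -
      have "C_k_on k ?S (\<lambda>z. integral {0..1} (\<lambda>t. t ^ (if fst b = 0 then j else Suc j) *
              f' (t * fst z, snd z) b))"
        by (rule Suc.IH[OF f'(2)[OF b]])
      also have "?this \<longleftrightarrow> ?thesis"
      proof (rule C_k_on_cong)
        fix z assume z: "z \<in> ?S"
        have "blinfun_apply (integral (cbox 0 1) (H z)) b = integral {0..1} (\<lambda>t. blinfun_apply (H z t) b)"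
          using blinfun_apply_integral[OF intH[OF z]] by simp
        also have "\<dots> = integral {0..1} (\<lambda>t. t ^ (if fst b = 0 then j else Suc j) * f' (t * fst z, snd z) b)"
        proof (rule integral_cong)
          fix t :: real assume "t \<in> {0..1}"
          then show "blinfun_apply (H z t) b = t ^ (if fst b = 0 then j else Suc j) * f' (t * fst z, snd z) b"
            using h_basis[OF b z, of t] H[OF z, of t] by simp
        qed
        finally show "integral {0..1} (\<lambda>t. t ^ (if fst b = 0 then j else Suc j) * f' (t * fst z, snd z) b)
          = blinfun_apply (integral (cbox 0 1) (H z)) b" ..
      qed
      finally show ?thesis .
    qed
    ultimately show ?case unfolding C_k_on.simps cbox_interval
      by (intro exI[of _ "\<lambda>z. blinfun_apply (integral {0..1} (H z))"] conjI ballI)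
  }
qed

text \<open>Hadamard's lemma: \<open>f (a, z) = a * (\<integral>t\<in>{0..1}. \<partial>f/\<partial>a (t * a, z))\<close>.\<close>

lemma smooth_on_divide_boundary_coordinate:
  fixes f :: "real \<times> 'b::euclidean_space \<Rightarrow> real"
  assumes "e > 0" "convex T" "coordinate_perfect T"
    and f: "smooth_on ({0..<e} \<times> T) f" and zero: "\<And>z. z \<in> T \<Longrightarrow> f (0, z) = 0"
  obtains g where "smooth_on ({0..<e} \<times> T) g"
    and "\<And>a z. a \<in> {0..<e} \<Longrightarrow> z \<in> T \<Longrightarrow> f (a, z) = a * g (a, z)"
proof
  let ?S = "{0..<e} \<times> T"
  define f1 where "f1 x = frechet_derivative f (at x within ?S) (1, 0)" for x
  define g where "g z = integral {0..1} (\<lambda>t. t ^ 0 * f1 (t * fst z, snd z))" for z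
  have perf: "coordinate_perfect ?S"
    using assms by (intro coordinate_perfect_Times coordinate_perfect_interval[of _ 0 "e/2"])
       (auto simp: is_interval_def)
  have f1: "smooth_on ?S f1"
    unfolding f1_def by (rule smooth_on_partial[OF f perf]) (simp add: Basis_prod_def)
  show "smooth_on ?S g"
    using f1 C_k_on_ray_average[OF assms(2)] unfolding smooth_on_def g_def by blast
  fix a z assume az: "a \<in> {0..<e}" "z \<in> T"
  have "((\<lambda>t. f (t * a, z)) has_vector_derivative a * f1 (t * a, z)) (at t within {0..1})"
    if t: "t \<in> {0..1}" for t
  proof -
    let ?D = "frechet_derivative f (at (t * a, z) within ?S)"
    have sub: "(\<lambda>t. (t * a, z)) ` {0..1} \<subseteq> ?S"
    proof
      fix y assume "y \<in> (\<lambda>t. (t * a, z)) ` {0..1}"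
      then obtain t where t: "t \<in> {0..1}" "y = (t * a, z)" by blast
      have "t * a \<le> a" "0 \<le> t * a" using t az by (auto intro!: mult_left_le_one_le)
      moreover have "a < e" "z \<in> T" using az by auto
      ultimately have "0 \<le> t * a" "t * a < e" by linarith+
      then show "y \<in> ?S" using t(2) \<open>z \<in> T\<close> by simp
    qed
    have "((\<lambda>t. f (t * a, z)) has_derivative (\<lambda>h. ?D (h * a, 0))) (at t within {0..1})"
      by (rule has_derivative_in_compose2[OF smooth_on_has_derivative[OF f] sub t]) (auto intro!: derivative_eq_intros)
    moreover have "?D (h * a, 0) = h * (a * f1 (t * a, z))" for h
    proof -
      have "linear ?D" using smooth_on_has_derivative[OF f, of "(t * a, z)"] sub t has_derivative_linear by blast
      from linear_scale[OF this, of "h * a" "(1, 0)"] show ?thesis by (simp add: f1_def)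
    qed
    ultimately show ?thesis by (simp add: has_vector_derivative_def)
  qed
  then have "((\<lambda>t. a * f1 (t * a, z)) has_integral f (1 * a, z) - f (0 * a, z)) {0..1}"
    by (intro fundamental_theorem_of_calculus) auto
  then show "f (a, z) = a * g (a, z)"
    using zero[OF az(2)] integral_unique[of "\<lambda>t. a * f1 (t * a, z)"] by (simp add: g_def)
qed

text \<open>
  The base point may be a boundary point of \<open>Z\<close>, so the derivative is extracted from the first-order
  expansion of \<open>G\<close> at points of the graph, without inverting any map.
\<close>

lemma has_derivative_implicit:
  fixes G :: "'a::euclidean_space \<times> real \<Rightarrow> real" and g :: "'a \<Rightarrow> real"
  assumes D: "(G has_derivative D) (at (z0, g z0) within Z \<times> I)"
    and c: "D (0, 1) \<noteq> 0" and z0: "z0 \<in> Z"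
    and g: "continuous_on Z g" "g ` Z \<subseteq> I" and G: "\<And>z. z \<in> Z \<Longrightarrow> G (z, g z) = 0"
  shows "(g has_derivative (\<lambda>h. - (D (h, 0) / D (0, 1)))) (at z0 within Z)"
proof -
  define c where "c = D (0, 1)"
  have bl: "bounded_linear D" using D by (rule has_derivative_bounded_linear)
  then interpret D: bounded_linear D .
  have bl2: "bounded_linear (\<lambda>h. - (D (h, 0) / c))"
    by (intro bounded_linear_minus bounded_linear_divide[THEN bounded_linear_compose]
        bounded_linear_compose[OF bl] bounded_linear_Pair bounded_linear_ident bounded_linear_zero)
  obtain B where B: "B > 0" "\<And>x. \<bar>D x\<bar> \<le> norm x * B" using D.pos_bounded by auto
  have split: "D (h, y) = D (h, 0) + c * y" for h y
    using D.add[of "(h, 0)" "(0, y)"] D.scaleR[of y "(0, 1)"] by (simp add: c_def)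
  have "c \<noteq> 0" using c by (simp add: c_def)
  define K where "K = 2 * (B + \<bar>c\<bar>) / \<bar>c\<bar>"
  have "K \<ge> 0" using B \<open>c \<noteq> 0\<close> by (simp add: K_def)
  have "\<exists>d>0. \<forall>z\<in>Z. norm (z - z0) < d \<longrightarrow>
      norm (g z - g z0 - - (D (z - z0, 0) / c)) \<le> e * norm (z - z0)" if "e > 0" for e
  proof -
    define e' where "e' = min (\<bar>c\<bar> / 2) (e * \<bar>c\<bar> / (1 + K))"
    have e': "0 < e'" "e' \<le> \<bar>c\<bar> / 2"
      using \<open>e > 0\<close> \<open>c \<noteq> 0\<close> \<open>K \<ge> 0\<close> by (simp add: e'_def, simp only: e'_def min.cobounded1)
    have "e' * (1 + K) \<le> e * \<bar>c\<bar> / (1 + K) * (1 + K)"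
      using \<open>K \<ge> 0\<close> unfolding e'_def by (intro mult_right_mono) auto
    then have e'3: "e' * (1 + K) \<le> e * \<bar>c\<bar>" using \<open>K \<ge> 0\<close> by simp
    obtain d1 where d1: "d1 > 0" and small: "\<And>z y. (z, y) \<in> Z \<times> I \<Longrightarrow> norm ((z, y) - (z0, g z0)) < d1 \<Longrightarrow>
        norm (G (z, y) - G (z0, g z0) - D ((z, y) - (z0, g z0))) \<le> e' * norm ((z, y) - (z0, g z0))"
      using D e'(1) unfolding has_derivative_within_alt by (metis (no_types, lifting))
    obtain d2 where d2: "d2 > 0" "\<And>z. z \<in> Z \<Longrightarrow> dist z z0 < d2 \<Longrightarrow> dist (g z) (g z0) < d1 / 2"
      using g(1) z0 d1 unfolding continuous_on_iff by (meson half_gt_zero)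
    show ?thesis
    proof (intro exI[of _ "min d2 (d1 / 2)"] conjI ballI impI)
      show "min d2 (d1 / 2) > 0" using d1 d2 by simp
      fix z assume z: "z \<in> Z" "norm (z - z0) < min d2 (d1 / 2)"
      define n where "n = norm (z - z0)"
      define y where "y = g z - g z0"
      have tri: "norm (z - z0, y) \<le> n + \<bar>y\<bar>" using norm_Pair_le[of "z - z0" y] by (simp add: n_def)
      have "\<bar>y\<bar> < d1 / 2" using d2(2)[OF z(1)] z(2) by (simp add: y_def dist_norm)
      then have "norm ((z, g z) - (z0, g z0)) < d1"
        using tri z(2) by (simp add: y_def n_def)
      from small[OF _ this] have "\<bar>D (z - z0, y)\<bar> \<le> e' * norm (z - z0, y)"
        using G z z0 g(2) by (auto simp: y_def)
      also have "\<dots> \<le> e' * (n + \<bar>y\<bar>)" using tri e'(1) by simp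
      finally have main: "\<bar>D (z - z0, 0) + c * y\<bar> \<le> e' * (n + \<bar>y\<bar>)" using split by metis
      \<comment> \<open>The estimate first gives a Lipschitz bound for \<open>g\<close> and is then used again with this bound.\<close>
      have "\<bar>D (z - z0, 0)\<bar> \<le> n * B" using B(2)[of "(z - z0, 0)"] by (simp add: n_def)
      moreover have "e' * (n + \<bar>y\<bar>) \<le> \<bar>c\<bar> / 2 * (n + \<bar>y\<bar>)"
        using e'(2) by (intro mult_right_mono) (auto simp: n_def)
      ultimately have "\<bar>c * y\<bar> \<le> n * B + \<bar>c\<bar> / 2 * (n + \<bar>y\<bar>)" using main by linarith
      then have "\<bar>c\<bar> * \<bar>y\<bar> \<le> n * B + \<bar>c\<bar> / 2 * n + (\<bar>c\<bar> * \<bar>y\<bar>) / 2"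
        by (simp add: abs_mult algebra_simps add_divide_distrib)
      then have "\<bar>c\<bar> * \<bar>y\<bar> \<le> 2 * (n * B) + \<bar>c\<bar> * n" by linarith
      also have "\<dots> \<le> (2 * (B + \<bar>c\<bar>)) * n" by (simp add: n_def algebra_simps)
      also have "2 * (B + \<bar>c\<bar>) = \<bar>c\<bar> * K" using \<open>c \<noteq> 0\<close> by (simp add: K_def)
      finally have yK: "\<bar>y\<bar> \<le> K * n" using \<open>c \<noteq> 0\<close> by (simp add: mult.assoc)
      have "\<bar>c\<bar> * \<bar>y + D (z - z0, 0) / c\<bar> = \<bar>D (z - z0, 0) + c * y\<bar>"
        using \<open>c \<noteq> 0\<close> by (simp flip: abs_mult add: field_simps)
      also have "\<dots> \<le> e' * (n + K * n)" using main yK e'(1) 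
        by (meson add_left_mono less_imp_le mult_left_mono order_trans)
      also have "\<dots> \<le> (e * \<bar>c\<bar>) * n" using mult_right_mono[OF e'3, of n] by (simp add: n_def algebra_simps)
      finally have "\<bar>y + D (z - z0, 0) / c\<bar> \<le> e * n" using \<open>c \<noteq> 0\<close> 
        by (simp add: mult.commute mult.left_commute)
      then show "norm (g z - g z0 - - (D (z - z0, 0) / c)) \<le> e * norm (z - z0)"
        by (simp add: y_def n_def)
    qed
  qed
  with bl2 show ?thesis unfolding has_derivative_within_alt c_def by blast
qed

text \<open>
  The gradient of the implicit function is a quotient of partial derivatives of \<open>G\<close> along its
  graph, so each order of differentiability gives the next.
\<close>

lemma smooth_on_implicit:
  fixes G :: "'a::euclidean_space \<times> real \<Rightarrow> real"
  assumes G: "smooth_on (Z \<times> I) G" and perf: "coordinate_perfect (Z \<times> I)"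
    and c: "\<And>z. z \<in> Z \<Longrightarrow> frechet_derivative G (at (z, g z) within Z \<times> I) (0, 1) \<noteq> 0"
    and g: "continuous_on Z g" "g ` Z \<subseteq> I" and zero: "\<And>z. z \<in> Z \<Longrightarrow> G (z, g z) = 0"
  shows "smooth_on Z g"
proof -
  define D where "D x = frechet_derivative G (at x within Z \<times> I)" for x
  have "C_k_on k Z g" for k
  proof (induction k)
    case 0
    then show ?case using g by simp
  next
    case (Suc k)
    have along: "C_k_on k Z (\<lambda>z. D (z, g z) b)" if b: "b \<in> Basis" for b
    proof (rule C_k_on_compose[of "\<lambda>z. (z, g z)" Z "Z \<times> I" k "\<lambda>x. D x b"])
      show "(\<lambda>z. (z, g z)) ` Z \<subseteq> Z \<times> I" using g by auto
      show "C_k_on k (Z \<times> I) (\<lambda>x. D x b)"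
        using smooth_on_partial[OF G perf b] unfolding D_def smooth_on_def by blast
      show "C_k_on k Z (\<lambda>z. (z, g z) \<bullet> c)" if "c \<in> Basis" for c
      proof -
        have "C_k_on k Z (\<lambda>z. z \<bullet> fst c + g z * snd c)"
          by (intro C_k_on_add C_k_on_mult C_k_on_const Suc C_k_on_bounded_linear bounded_linear_inner_left)
        then show ?thesis by (simp add: inner_prod_def)
      qed
    qed
    have "(g has_derivative (\<lambda>h. - (D (z, g z) (h, 0) / D (z, g z) (0, 1)))) (at z within Z)"
      if "z \<in> Z" for z
      using smooth_on_has_derivative[OF G, of "(z, g z)"] that g c zero
      by (intro has_derivative_implicit[of G _ z g Z I]) (auto simp: D_def)
    moreover have "C_k_on k Z (\<lambda>z. - (D (z, g z) (b, 0) / D (z, g z) (0, 1)))" if "b \<in> Basis" for b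
      unfolding divide_inverse
      by (intro C_k_on_minus C_k_on_mult C_k_on_inverse along)
         (use c that in \<open>auto simp: D_def Basis_prod_def\<close>)
    ultimately show ?case
      by (auto intro!: exI[of _ "\<lambda>z h. - (D (z, g z) (h, 0) / D (z, g z) (0, 1))"])
  qed
  then show ?thesis by (simp add: smooth_on_def)
qed

section \<open>The soliton\<close>

lemma cosh_ge_half_exp_abs: "exp \<bar>x::real\<bar> / 2 \<le> cosh x"
  by (cases "x \<ge> 0") (auto simp: cosh_def)

lemma Q_pos: "p > 0 \<Longrightarrow> Q p x > 0"
  unfolding Q_def by (auto intro!: mult_pos_pos)

lemma Q_0: "p > 0 \<Longrightarrow> Q p 0 powr p = (p + 2) / 2"
  by (simp add: Q_def powr_powr)

lemma Q_powr: "p > 0 \<Longrightarrow> Q p x powr p = (p + 2) / 2 * (1 - (tanh (p * x / 2))\<^sup>2)"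
proof -
  assume p: "p > 0"
  have "Q p x powr p = (p + 2) / 2 * (1 / cosh (p * x / 2)) powr 2"
    using p by (simp add: Q_def powr_mult powr_powr)
  also have "(1 / cosh (p * x / 2)) powr 2 = 1 - (tanh (p * x / 2))\<^sup>2"
    using cosh_square_eq[of "p * x / 2"] zero_le_power2[of "sinh (p * x / 2)"]
    by (simp add: powr_numeral tanh_def power_divide add_nonneg_eq_0_iff divide_simps)
  finally show ?thesis .
qed

definition Q_deriv :: "real \<Rightarrow> real \<Rightarrow> real" where
  "Q_deriv p x = - Q p x * tanh (p * x / 2)"

lemma Q_has_derivative: "p > 0 \<Longrightarrow> (Q p has_real_derivative Q_deriv p x) (at x)"
proof -
  assume p: "p > 0"
  define y where "y = p * x / 2"
  have c: "cosh y > 0" by simp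
  have "((\<lambda>x. ((p + 2) / 2) powr (1 / p) * (1 / cosh (p * x / 2)) powr (2 / p)) has_real_derivative
      ((p + 2) / 2) powr (1 / p) * ((2 / p) * (1 / cosh y) powr (2 / p - 1) * (- (sinh y * (p / 2)) / (cosh y)\<^sup>2))) (at x)"
    unfolding y_def using c[unfolded y_def] 
    by (auto intro!: derivative_eq_intros simp: power2_eq_square)
  also have "(1 / cosh y) powr (2 / p - 1) = (1 / cosh y) powr (2 / p) * cosh y"
    using c by (simp add: powr_diff)
  also have "((p + 2) / 2) powr (1 / p) * ((2 / p) * ((1 / cosh y) powr (2 / p) * cosh y) * (- (sinh y * (p / 2)) / (cosh y)\<^sup>2))
     = Q_deriv p x"
    using c p by (simp add: Q_deriv_def Q_def tanh_def y_def power2_eq_square)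
  finally show ?thesis unfolding Q_def[abs_def] .
qed

lemma Q_deriv_has_derivative: "p > 0 \<Longrightarrow> (Q_deriv p has_real_derivative Q p x - Q p x powr p * Q p x) (at x)"
proof -
  assume p: "p > 0"
  have c: "cosh (p * x / 2) > 0" by simp
  define t where "t = tanh (p * x / 2)"
  have "((\<lambda>x. - Q p x * tanh (p * x / 2)) has_real_derivative
     - Q_deriv p x * tanh (p * x / 2) - Q p x * ((1 - (tanh (p * x / 2))\<^sup>2) * (p / 2))) (at x)"
    using c by (auto intro!: derivative_eq_intros Q_has_derivative[OF p])
  also have "- Q_deriv p x * tanh (p * x / 2) - Q p x * ((1 - (tanh (p * x / 2))\<^sup>2) * (p / 2)) =
     Q p x - Q p x powr p * Q p x"
    unfolding Q_powr[OF p] Q_deriv_def t_def[symmetric] by (simp add: field_simps power2_eq_square)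
  finally show ?thesis unfolding Q_deriv_def[abs_def] .
qed

lemma continuous_on_Q: "p > 0 \<Longrightarrow> continuous_on A (Q p)" "p > 0 \<Longrightarrow> continuous_on A (Q_deriv p)"
  by (meson DERIV_isCont Q_has_derivative continuous_at_imp_continuous_on)
     (meson DERIV_isCont Q_deriv_has_derivative continuous_at_imp_continuous_on)

lemma deriv_Q: "p > 0 \<Longrightarrow> deriv (Q p) = Q_deriv p"
  using Q_has_derivative by (intro ext DERIV_imp_deriv)

lemma deriv2_Q: "p > 0 \<Longrightarrow> (deriv ^^ 2) (Q p) x = Q p x - Q p x powr p * Q p x"
  using Q_deriv_has_derivative[of p x] by (simp add: numeral_2_eq_2 deriv_Q DERIV_imp_deriv)

lemma Q_le_exp:
  assumes "p > 0"
  obtains K where "K > 0" "\<And>x. Q p x \<le> K * exp (- \<bar>x\<bar>)"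
proof
  define A where "A = ((p + 2) / 2) powr (1 / p)"
  have A: "A > 0" using assms by (simp add: A_def)
  then show "A * 2 powr (2 / p) > 0" by simp
  fix x
  have e: "\<bar>p * x / 2\<bar> = p * \<bar>x\<bar> / 2" using assms by (simp add: abs_mult)
  have "1 / cosh (p * x / 2) \<le> 1 / (exp (p * \<bar>x\<bar> / 2) / 2)"
    using cosh_ge_half_exp_abs[of "p * x / 2"] unfolding e by (intro divide_left_mono) auto
  also have "\<dots> = 2 * exp (- (p * \<bar>x\<bar> / 2))" by (simp add: exp_minus field_simps)
  finally have "(1 / cosh (p * x / 2)) powr (2 / p) \<le> (2 * exp (- (p * \<bar>x\<bar> / 2))) powr (2 / p)"
    using assms by (intro powr_mono2) auto
  also have "\<dots> = 2 powr (2 / p) * exp (- \<bar>x\<bar>)"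
    using assms by (simp add: powr_def ln_mult distrib_left flip: exp_add) (simp add: field_simps)
  finally show "Q p x \<le> A * 2 powr (2 / p) * exp (- \<bar>x\<bar>)"
    using A by (simp add: Q_def A_def mult.assoc)
qed

lemma abs_Q_deriv_le: "p > 0 \<Longrightarrow> \<bar>Q_deriv p x\<bar> \<le> Q p x"
  using Q_pos[of p x] tanh_real_bounds[of "p * x / 2"]
  by (auto simp: Q_deriv_def abs_mult intro!: mult_left_le)

lemma integrable_inverse_one_plus_square: "integrable lborel (\<lambda>x::real. inverse (1 + x\<^sup>2))"
proof -
  have "set_integrable lborel (einterval (-\<infinity>) \<infinity>) (\<lambda>x::real. inverse (1 + x\<^sup>2))"
    by (rule interval_integral_FTC_nonneg(1)[where F = arctan and A = "- (pi / 2)" and B = "pi / 2"])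
       (auto intro!: derivative_eq_intros continuous_intros simp: ereal_tendsto_simps tendsto_arctan_at_bot
          tendsto_arctan_at_top add_nonneg_eq_0_iff)
  then show ?thesis by (simp add: set_integrable_def)
qed

lemma linear_times_exp_le_inverse_square: "(1 + \<bar>x::real\<bar>) * exp (- \<bar>x\<bar>) \<le> 8 * inverse (1 + x\<^sup>2)"
proof -
  define t where "t = \<bar>x\<bar>"
  have t: "t \<ge> 0" "x\<^sup>2 = t\<^sup>2" by (auto simp: t_def)
  \<comment> \<open>Squaring the quadratic Taylor bound at \<open>t / 2\<close> supplies the cubic term.\<close>
  have "(1 + t / 2 + (t / 2)\<^sup>2 / 2)\<^sup>2 \<le> (exp (t / 2))\<^sup>2"
    using t by (intro power_mono exp_lower_Taylor_quadratic) auto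
  also have "(exp (t / 2))\<^sup>2 = exp t" by (simp flip: exp_of_nat_mult)
  moreover have "(1 + t) * (1 + t\<^sup>2) \<le> 8 * (1 + t / 2 + (t / 2)\<^sup>2 / 2)\<^sup>2"
    using t(1) by (simp add: power2_eq_square field_simps)
  ultimately have "(1 + t) * (1 + t\<^sup>2) \<le> 8 * exp t" by linarith
  moreover have "1 + t\<^sup>2 > 0" by (simp add: add_pos_nonneg)
  ultimately show ?thesis unfolding t(2) t_def[symmetric]
    by (simp add: exp_minus field_simps)
qed

lemma integrable_lborel_if_exp_bound:
  fixes f :: "real \<Rightarrow> real"
  assumes "continuous_on UNIV f" "\<And>x. \<bar>f x\<bar> \<le> K * ((1 + \<bar>x\<bar>) * exp (- \<bar>x\<bar>))"
  shows "integrable lborel f"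
proof (rule Bochner_Integration.integrable_bound)
  show "integrable lborel (\<lambda>x. \<bar>K\<bar> * 8 * inverse (1 + x\<^sup>2))"
    by (intro integrable_mult_right integrable_inverse_one_plus_square)
  show "f \<in> borel_measurable lborel" using assms(1) by (simp add: borel_measurable_continuous_onI)
  show "AE x in lborel. norm (f x) \<le> norm (\<bar>K\<bar> * 8 * inverse (1 + x\<^sup>2))"
  proof (rule AE_I2)
    fix x :: real
    have "\<bar>f x\<bar> \<le> \<bar>K\<bar> * ((1 + \<bar>x\<bar>) * exp (- \<bar>x\<bar>))"
      by (rule order_trans[OF assms(2)]) (auto intro!: mult_right_mono)
    also have "\<dots> \<le> \<bar>K\<bar> * (8 * inverse (1 + x\<^sup>2))"
      by (intro mult_left_mono linear_times_exp_le_inverse_square) simp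
    finally show "norm (f x) \<le> norm (\<bar>K\<bar> * 8 * inverse (1 + x\<^sup>2))"
      by (simp add: abs_mult)
  qed
qed

lemma lborel_integral_pos:
  fixes f :: "real \<Rightarrow> real"
  assumes "integrable lborel f" "\<And>x. 0 \<le> f x" "\<And>x. x \<noteq> 0 \<Longrightarrow> f x \<noteq> 0"
  shows "0 < (\<integral>x. f x \<partial>lborel)"
proof -
  have "(\<integral>x. f x \<partial>lborel) \<noteq> 0"
  proof
    assume "(\<integral>x. f x \<partial>lborel) = 0"
    then have "AE x in lborel. f x = 0"
      using integral_nonneg_eq_0_iff_AE[OF assms(1)] assms(2) by simp
    with AE_lborel_singleton[of "0::real"] have "AE x in (lborel :: real measure). False"
      by eventually_elim (use assms(3) in auto)
    then have "emeasure (lborel :: real measure) UNIV = 0"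
      by (subst (asm) AE_iff_measurable[where N = UNIV]) auto
    then show False by simp
  qed
  moreover have "0 \<le> (\<integral>x. f x \<partial>lborel)" using assms(2) by simp
  ultimately show ?thesis by simp
qed

lemma integrable_soliton_sq:
  assumes "p > 0"
  shows "integrable lborel (\<lambda>x. (Q p x)\<^sup>2)" "integrable lborel (\<lambda>x. (Q_deriv p x)\<^sup>2)"
proof -
  obtain L where L: "L > 0" "\<And>x. Q p x \<le> L * exp (- \<bar>x\<bar>)" using Q_le_exp[OF assms] by blast
  have "(Q p x)\<^sup>2 \<le> L\<^sup>2 * ((1 + \<bar>x\<bar>) * exp (- \<bar>x\<bar>))" for x
  proof -
    have "(Q p x)\<^sup>2 \<le> (L * exp (- \<bar>x\<bar>))\<^sup>2"
      using L(2) Q_pos[OF assms, of x] by (intro power_mono) auto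
    also have "\<dots> = L\<^sup>2 * (exp (- \<bar>x\<bar>) * exp (- \<bar>x\<bar>))" by (simp add: power2_eq_square mult_ac)
    also have "\<dots> \<le> L\<^sup>2 * ((1 + \<bar>x\<bar>) * exp (- \<bar>x\<bar>))"
      by (intro mult_left_mono mult_right_mono) (auto intro: order_trans[of _ 1])
    finally show ?thesis .
  qed
  moreover from this have "(Q_deriv p x)\<^sup>2 \<le> L\<^sup>2 * ((1 + \<bar>x\<bar>) * exp (- \<bar>x\<bar>))" for x
    using abs_Q_deriv_le[OF assms, of x] Q_pos[OF assms, of x] power2_le_iff_abs_le[of "Q p x" "Q_deriv p x"]
    by (meson less_imp_le order_trans)
  ultimately show "integrable lborel (\<lambda>x. (Q p x)\<^sup>2)" "integrable lborel (\<lambda>x. (Q_deriv p x)\<^sup>2)"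
    using continuous_on_Q[OF assms]
    by (auto intro!: integrable_lborel_if_exp_bound[of _ "L\<^sup>2"] continuous_intros)
qed

lemma soliton_norms_pos:
  assumes "p > 0"
  shows "0 < (\<integral>x. (Q p x)\<^sup>2 \<partial>lborel)" "0 < (\<integral>x. (Q_deriv p x)\<^sup>2 \<partial>lborel)"
proof -
  have "Q p x \<noteq> 0" for x using Q_pos[OF assms, of x] by simp
  moreover have "Q_deriv p x \<noteq> 0" if "x \<noteq> 0" for x
    using calculation[of x] that assms by (simp add: Q_deriv_def)
  ultimately show "0 < (\<integral>x. (Q p x)\<^sup>2 \<partial>lborel)" "0 < (\<integral>x. (Q_deriv p x)\<^sup>2 \<partial>lborel)"
    by (auto intro!: lborel_integral_pos integrable_soliton_sq[OF assms])
qed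

section \<open>Norms of the critical soliton\<close>

text \<open>
  The substitution \<open>t = 1 / (1 + exp (- 2 * y))\<close> has \<open>dt = 2 * t * (1 - t) * dy\<close> and
  \<open>t * (1 - t) = (1 / cosh y)\<^sup>2 / 4\<close>, which turns the integral into a Beta integral.
\<close>

lemma lborel_integral_sech_powr:
  fixes s :: real
  assumes "s > 0"
  shows "integrable lborel (\<lambda>y::real. (1 / cosh y) powr s)"
    "(\<integral>y. (1 / cosh y) powr s \<partial>lborel) = 2 powr (s - 1) * Beta (s / 2) (s / 2)"
proof -
  have "integrable lborel (\<lambda>x::real. exp (- \<bar>x\<bar>))"
    by (rule integrable_lborel_if_exp_bound[of _ 1]) (auto intro!: continuous_intros)
  then have "integrable lborel (\<lambda>y. 2 powr s * exp (- \<bar>0 + s * y\<bar>))"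
    using assms by (intro integrable_mult_right lborel_integrable_real_affine) auto
  then show int: "integrable lborel (\<lambda>y::real. (1 / cosh y) powr s)"
  proof (rule Bochner_Integration.integrable_bound)
    show "AE y in lborel. norm ((1 / cosh y) powr s) \<le> norm (2 powr s * exp (- \<bar>0 + s * y\<bar>))"
    proof (rule AE_I2)
      fix y :: real
      have "1 / cosh y \<le> 1 / (exp \<bar>y\<bar> / 2)"
        using cosh_ge_half_exp_abs[of y] by (intro divide_left_mono) auto
      also have "\<dots> = 2 * exp (- \<bar>y\<bar>)" by (simp add: exp_minus field_simps)
      finally have "(1 / cosh y) powr s \<le> (2 * exp (- \<bar>y\<bar>)) powr s"
        using assms by (intro powr_mono2) auto
      also have "\<dots> = 2 powr s * exp (- \<bar>0 + s * y\<bar>)"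
        using assms by (simp add: powr_def ln_mult abs_mult distrib_left right_diff_distrib flip: exp_add)
      finally show "norm ((1 / cosh y) powr s) \<le> norm (2 powr s * exp (- \<bar>0 + s * y\<bar>))" by simp
    qed
    have "continuous_on UNIV (\<lambda>y::real. (1 / cosh y) powr s)"
      by (intro continuous_intros) auto
    then show "(\<lambda>y::real. (1 / cosh y) powr s) \<in> borel_measurable lborel"
      by (simp add: borel_measurable_continuous_onI)
  qed
  define g where "g y = 1 / (1 + exp (- 2 * y))" for y :: real
  define g' where "g' y = 2 * g y * (1 - g y)" for y
  define f where "f t = 2 powr (s - 1) * (t powr (s / 2 - 1) * (1 - t) powr (s / 2 - 1))" for t :: real
  have g_pos: "0 < g y" "g y < 1" for y by (auto simp: g_def add_pos_pos)
  have dg: "(g has_real_derivative g' y) (at y)" for y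
  proof -
    have "1 + exp (- 2 * y) \<noteq> 0" using exp_gt_zero[of "-2*y"] by linarith
    then show ?thesis unfolding g_def[abs_def] g'_def
      by (auto intro!: derivative_eq_intros simp: divide_simps power2_eq_square)
  qed
  have sech: "g y * (1 - g y) = (1 / cosh y)\<^sup>2 / 4" for y
  proof -
    have "1 + exp (- 2 * y) = 2 * cosh y * exp (- y)"
      by (simp add: cosh_def algebra_simps flip: exp_add)
    then have "g y = 1 / (2 * cosh y * exp (- y))" by (simp only: g_def)
    also have "\<dots> = exp y / (2 * cosh y)" by (simp add: exp_minus field_simps)
    finally have "g y = exp y / (2 * cosh y)" .
    moreover have "1 - exp y / (2 * cosh y) = exp (- y) / (2 * cosh y)"
    proof -
      have "2 * cosh y - exp y = exp (- y)" by (simp add: cosh_def field_simps)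
      moreover have "1 - exp y / (2 * cosh y) = (2 * cosh y - exp y) / (2 * cosh y)"
        by (simp add: diff_divide_distrib)
      ultimately show ?thesis by (simp only:)
    qed
    ultimately show ?thesis by (simp add: power2_eq_square flip: exp_add)
  qed
  have fg: "f (g y) * g' y = (1 / cosh y) powr s" for y
  proof -
    have "f (g y) * g' y = 2 powr s * ((g y * (1 - g y)) powr (s / 2 - 1) * (g y * (1 - g y)))"
      using g_pos[of y] by (simp add: f_def g'_def powr_mult powr_diff)
    also have "\<dots> = 2 powr s * (g y * (1 - g y)) powr (s / 2)"
      using g_pos[of y] by (simp add: powr_diff)
    also have "\<dots> = 2 powr s * ((1 / cosh y / 2) powr 2) powr (s / 2)"
      unfolding sech by (simp add: powr_numeral power_divide)
    also have "\<dots> = (1 / cosh y) powr s"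
      unfolding powr_powr by (simp add: powr_divide powr_mult)
    finally show ?thesis .
  qed
  have lim: "(g \<longlongrightarrow> 0) at_bot" "(g \<longlongrightarrow> 1) at_top"
  proof -
    have l: "filterlim (\<lambda>y::real. - 2 * y) at_bot at_top"
      by (rule filterlim_tendsto_neg_mult_at_bot[OF tendsto_const _ filterlim_ident]) simp
    have "filterlim (\<lambda>y::real. 2 * y) at_top at_top"
      by (rule filterlim_tendsto_pos_mult_at_top[OF tendsto_const _ filterlim_ident]) simp
    then have l': "filterlim (\<lambda>y::real. - 2 * y) at_top at_bot" by (simp add: filterlim_at_bot_mirror)
    have "filterlim (\<lambda>y::real. 1 + exp (- 2 * y)) at_top at_bot"
      by (intro filterlim_tendsto_add_at_top[OF tendsto_const] filterlim_compose[OF exp_at_top] l')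
    then show "(g \<longlongrightarrow> 0) at_bot" unfolding g_def[abs_def]
      by (intro tendsto_divide_0[OF tendsto_const] filterlim_at_top_imp_at_infinity)
    have "((\<lambda>y::real. exp (- 2 * y)) \<longlongrightarrow> 0) at_top"
      by (rule filterlim_compose[OF exp_at_bot l])
    then have "(g \<longlongrightarrow> 1 / (1 + 0)) at_top" unfolding g_def[abs_def]
      by (intro tendsto_intros) auto
    then show "(g \<longlongrightarrow> 1) at_top" by simp
  qed
  have cg: "isCont g y" for y using dg DERIV_isCont by blast
  have prems: "isCont f (g y)" "isCont g' y" "0 \<le> f (g y)" "0 \<le> g' y" for y
    unfolding f_def g'_def using g_pos[of y]
    by (auto intro!: continuous_intros cg)
  have ends: "((ereal \<circ> g \<circ> real_of_ereal) \<longlongrightarrow> 0) (at_right (- \<infinity>))"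
      "((ereal \<circ> g \<circ> real_of_ereal) \<longlongrightarrow> 1) (at_left \<infinity>)"
    using lim by (simp_all add: ereal_tendsto_simps zero_ereal_def one_ereal_def)
  have "set_integrable lborel (einterval (- \<infinity>) \<infinity>) (\<lambda>y. f (g y) * g' y)"
    using int by (simp add: fg set_integrable_def)
  note substitution = interval_integral_substitution_nonneg[OF _ dg prems ends this]
  have "set_integrable lborel (einterval 0 1) f"
    "(LBINT t=0..1. f t) = (LBINT y=-\<infinity>..\<infinity>. (f (g y) * g' y))"
    by (rule substitution(1), simp) (rule substitution(2), simp)
  then have f: "set_integrable lborel {0<..<1} f" and
    eq: "(\<integral>y. (1 / cosh y) powr s \<partial>lborel) = set_lebesgue_integral lborel {0<..<1} f"
    by (simp_all add: interval_lebesgue_integral_def set_lebesgue_integral_def fg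
         einterval_eq zero_ereal_def one_ereal_def)
  have "(f has_integral 2 powr (s - 1) * Beta (s / 2) (s / 2)) {0<..<1}"
    unfolding f_def has_integral_Icc_iff_Ioo[symmetric]
    using has_integral_Beta_real[of "s/2" "s/2"] assms by (intro has_integral_mult_right) auto
  then show "(\<integral>y. (1 / cosh y) powr s \<partial>lborel) = 2 powr (s - 1) * Beta (s / 2) (s / 2)"
    using set_borel_integral_eq_integral(2)[OF f] eq by (metis integral_unique)
qed

lemma L1_norm_Q4_sq_div_L2_norm_Q4_sq:
  "(L1_norm (Q 4))\<^sup>2 / (L2_norm (Q 4))\<^sup>2 = Gamma (1/4) ^ 4 / (4 * pi\<^sup>2)"
proof -
  define S where "S r = (\<integral>y. (1 / cosh y) powr r \<partial>lborel)" for r :: real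
  have scale: "(\<integral>x. c * (1 / cosh (2 * x)) powr r \<partial>lborel) = c * (S r / 2)" for c r
    using lborel_integral_real_affine[of 2 "\<lambda>y. (1 / cosh y) powr r" 0] by (simp add: S_def)
  have q: "Q 4 x = 3 powr (1/4) * (1 / cosh (2 * x)) powr (1/2)" for x by (simp add: Q_def)
  have L1: "L1_norm (Q 4) = 3 powr (1/4) * (S (1/2) / 2)"
    unfolding L1_norm_def q scale[symmetric] by (simp add: abs_mult)
  have "(Q 4 x)\<^sup>2 = 3 powr (1/2) * (1 / cosh (2 * x)) powr 1" for x
    unfolding q power2_eq_square by (simp flip: powr_add add: mult_ac)
  then have "(\<integral>x. (Q 4 x)\<^sup>2 \<partial>lborel) = 3 powr (1/2) * (S 1 / 2)"
    by (simp only: scale)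
  moreover have "(L2_norm (Q 4))\<^sup>2 = (\<integral>x. (Q 4 x)\<^sup>2 \<partial>lborel)"
    unfolding L2_norm_def by (rule real_sqrt_pow2) (auto intro!: integral_nonneg_AE)
  ultimately have L2: "(L2_norm (Q 4))\<^sup>2 = 3 powr (1/2) * (S 1 / 2)" by (simp only:)
  have "(L1_norm (Q 4))\<^sup>2 / (L2_norm (Q 4))\<^sup>2 =
     (3 powr (1/4))\<^sup>2 * (S (1/2))\<^sup>2 / 4 / (3 powr (1/2) * (S 1 / 2))"
    unfolding L1 L2 by (simp add: power_mult_distrib power_divide)
  also have "(3 powr (1/4))\<^sup>2 = (3::real) powr (1/2)" by (simp add: power2_eq_square flip: powr_add)
  also have "3 powr (1/2) * (S (1/2))\<^sup>2 / 4 / (3 powr (1/2) * (S 1 / 2)) = (S (1/2))\<^sup>2 / (2 * S 1)"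
    by (simp add: field_simps)
  also have "S 1 = pi"
    using lborel_integral_sech_powr(2)[of 1] Gamma_one_half_real 
    by (simp add: S_def Beta_def flip: power2_eq_square)
  also have "S (1/2) = 2 powr (-1/2) * ((Gamma (1/4))\<^sup>2 / sqrt pi)"
    using lborel_integral_sech_powr(2)[of "1/2"] Gamma_one_half_real
    by (simp add: S_def Beta_def power2_eq_square)
  also have "(2 powr (-1/2) * ((Gamma (1/4))\<^sup>2 / sqrt pi))\<^sup>2 = (2 powr (-1/2))\<^sup>2 * (Gamma (1/4) ^ 4 / pi)"
    by (simp add: power_mult_distrib power_divide flip: power_mult)
  also have "(2 powr (-1/2))\<^sup>2 = (1/2::real)" by (simp add: power2_eq_square powr_minus_divide flip: powr_add)
  finally show ?thesis by (simp add: power2_eq_square)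
qed

section \<open>Testing the profile equation against the soliton\<close>

lemma lborel_integral_eq_limit_difference:
  fixes F f :: "real \<Rightarrow> real"
  assumes F: "\<And>x. (F has_real_derivative f x) (at x)" and f: "continuous_on UNIV f" "integrable lborel f"
    and lim: "(F \<longlongrightarrow> A) at_bot" "(F \<longlongrightarrow> B) at_top"
  shows "(\<integral>x. f x \<partial>lborel) = B - A"
proof -
  have "(LBINT x=-\<infinity>..\<infinity>. f x) = B - A"
  proof (rule interval_integral_FTC_integrable)
    show "set_integrable lborel (einterval (- \<infinity>) \<infinity>) f" using f by (simp add: set_integrable_def)
    show "((F \<circ> real_of_ereal) \<longlongrightarrow> A) (at_right (- \<infinity>))" "((F \<circ> real_of_ereal) \<longlongrightarrow> B) (at_left \<infinity>)"
      using lim by (simp_all add: ereal_tendsto_simps)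
  qed (use F f in \<open>auto simp: continuous_on_eq_continuous_at has_real_derivative_iff_has_vector_derivative\<close>)
  then show ?thesis
    by (simp add: interval_lebesgue_integral_def set_lebesgue_integral_def)
qed


lemma powr_second_order_bound:
  fixes u v M p :: real
  assumes p: "p \<ge> 1" and u: "0 < u" "u \<le> M" and v: "0 < v" "v \<le> M"
  shows "\<bar>u powr (p + 1) - v powr (p + 1) - (p + 1) * v powr p * (u - v)\<bar>
           \<le> (p + 1) * p * M powr (p - 1) * (u - v)\<^sup>2"
proof -
  define I where "I = {min u v..max u v}"
  have I: "convex I" "u \<in> I" "v \<in> I" "\<And>y. y \<in> I \<Longrightarrow> 0 < y \<and> y \<le> M \<and> \<bar>y - v\<bar> \<le> \<bar>u - v\<bar>"
    using u v by (auto simp: I_def)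
  have slope: "\<bar>(p + 1) * y powr p - (p + 1) * v powr p\<bar> \<le> (p + 1) * p * M powr (p - 1) * \<bar>u - v\<bar>"
    if y: "y \<in> I" for y
  proof -
    have "norm ((p + 1) * y powr p - (p + 1) * v powr p) \<le> ((p + 1) * p * M powr (p - 1)) * norm (y - v)"
    proof (rule field_differentiable_bound[OF I(1) _ _ y I(3)])
      fix z assume "z \<in> I"
      with I(4) have z: "0 < z" "z \<le> M" by auto
      then show "((\<lambda>y. (p + 1) * y powr p) has_field_derivative (p + 1) * (p * z powr (p - 1))) (at z within I)"
        by (auto intro!: derivative_eq_intros)
      show "norm ((p + 1) * (p * z powr (p - 1))) \<le> (p + 1) * p * M powr (p - 1)"
        using z p by (simp add: abs_mult powr_mono2)
    qed
    also have "\<dots> \<le> (p + 1) * p * M powr (p - 1) * \<bar>u - v\<bar>"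
      using I(4)[OF y] p by (intro mult_left_mono) auto
    finally show ?thesis by simp
  qed
  have "norm ((u powr (p + 1) - (p + 1) * v powr p * u) - (v powr (p + 1) - (p + 1) * v powr p * v))
     \<le> ((p + 1) * p * M powr (p - 1) * \<bar>u - v\<bar>) * norm (u - v)"
  proof (rule field_differentiable_bound[OF I(1) _ _ I(2,3)])
    fix z assume z: "z \<in> I"
    with I(4) have "0 < z" by auto
    then show "((\<lambda>y. y powr (p + 1) - (p + 1) * v powr p * y) has_field_derivative
         (p + 1) * z powr p - (p + 1) * v powr p) (at z within I)"
      by (auto intro!: derivative_eq_intros)
    show "norm ((p + 1) * z powr p - (p + 1) * v powr p) \<le> (p + 1) * p * M powr (p - 1) * \<bar>u - v\<bar>"
      using slope[OF z] by simp
  qed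
  moreover have "(u powr (p + 1) - (p + 1) * v powr p * u) - (v powr (p + 1) - (p + 1) * v powr p * v)
      = u powr (p + 1) - v powr (p + 1) - (p + 1) * v powr p * (u - v)"
    by (simp add: algebra_simps)
  moreover have "\<bar>u - v\<bar> * norm (u - v) = (u - v)\<^sup>2" by (simp add: power2_eq_square)
  ultimately show ?thesis by (simp only: mult.assoc real_norm_def)
qed

lemma tendsto_quadratic_times_exp_abs:
  fixes f h :: "real \<Rightarrow> real"
  assumes f: "\<And>x. \<bar>f x\<bar> \<le> K * (1 + \<bar>x\<bar>)\<^sup>2" and h: "\<And>x. \<bar>h x\<bar> \<le> L * exp (- \<bar>x\<bar>)"
  shows "((\<lambda>x. f x * h x) \<longlongrightarrow> 0) at_infinity"
proof (rule tendsto_0_le[where K = 1])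
  have "((\<lambda>t::real. K * L * (1 / exp t + 2 * (t ^ 1 / exp t) + t ^ 2 / exp t)) \<longlongrightarrow> K * L * (0 + 2 * 0 + 0)) at_top"
    using tendsto_power_div_exp_0[of 0] by (intro tendsto_intros tendsto_power_div_exp_0) simp
  then have "((\<lambda>t::real. K * L * (1 / exp t + 2 * (t ^ 1 / exp t) + t ^ 2 / exp t)) \<longlongrightarrow> 0) at_top" by simp
  moreover have "filterlim (\<lambda>x::real. \<bar>x\<bar>) at_top at_infinity"
    using filterlim_norm_at_top[where 'a = real] unfolding real_norm_def[abs_def] .
  ultimately show "((\<lambda>x::real. K * L * (1 / exp \<bar>x\<bar> + 2 * (\<bar>x\<bar> ^ 1 / exp \<bar>x\<bar>) + \<bar>x\<bar> ^ 2 / exp \<bar>x\<bar>)) \<longlongrightarrow> 0) at_infinity"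
    by (rule filterlim_compose)
  show "\<forall>\<^sub>F x in at_infinity. norm (f x * h x) \<le> norm (K * L * (1 / exp \<bar>x\<bar> + 2 * (\<bar>x\<bar> ^ 1 / exp \<bar>x\<bar>) + \<bar>x\<bar> ^ 2 / exp \<bar>x\<bar>)) * 1"
  proof (rule always_eventually, rule allI)
    fix x :: real
    have "norm (f x * h x) \<le> (K * (1 + \<bar>x\<bar>)\<^sup>2) * (L * exp (- \<bar>x\<bar>))"
      unfolding norm_mult using f h by (intro mult_mono) (auto intro: order_trans[OF abs_ge_zero])
    also have "\<dots> = K * L * (1 / exp \<bar>x\<bar> + 2 * (\<bar>x\<bar> ^ 1 / exp \<bar>x\<bar>) + \<bar>x\<bar> ^ 2 / exp \<bar>x\<bar>)"
      by (simp add: exp_minus field_simps power2_eq_square)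
    finally show "norm (f x * h x) \<le> norm (K * L * (1 / exp \<bar>x\<bar> + 2 * (\<bar>x\<bar> ^ 1 / exp \<bar>x\<bar>) + \<bar>x\<bar> ^ 2 / exp \<bar>x\<bar>)) * 1"
      by simp
  qed
qed

lemma polynomial_growth_from_derivative:
  fixes f f' :: "real \<Rightarrow> real"
  assumes f: "\<And>x. (f has_real_derivative f' x) (at x)"
    and bound: "\<And>x. \<bar>f' x\<bar> \<le> K * (1 + \<bar>x\<bar>) ^ n"
  shows "\<bar>f x\<bar> \<le> (\<bar>f 0\<bar> + K) * (1 + \<bar>x\<bar>) ^ Suc n"
proof -
  have K: "K \<ge> 0" using bound[of 0] by simp
  have "norm (f x - f 0) \<le> K * (1 + \<bar>x\<bar>) ^ n * norm (x - 0)"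
  proof (rule field_differentiable_bound[where S = "{min 0 x..max 0 x}"])
    fix z assume "z \<in> {min 0 x..max 0 x}"
    then have "\<bar>z\<bar> \<le> \<bar>x\<bar>" by (auto simp: min_def max_def split: if_splits)
    then have "K * (1 + \<bar>z\<bar>) ^ n \<le> K * (1 + \<bar>x\<bar>) ^ n"
      using K by (intro mult_left_mono power_mono) auto
    then show "norm (f' z) \<le> K * (1 + \<bar>x\<bar>) ^ n" using bound[of z] by simp
  qed (auto intro: has_field_derivative_at_within[OF f])
  moreover have "\<bar>f 0\<bar> * 1 \<le> \<bar>f 0\<bar> * (1 + \<bar>x\<bar>) ^ Suc n"
    by (intro mult_left_mono one_le_power) auto
  moreover have "K * (1 + \<bar>x\<bar>) ^ n * \<bar>x\<bar> \<le> K * (1 + \<bar>x\<bar>) ^ n * (1 + \<bar>x\<bar>)"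
    using K by (intro mult_left_mono) auto
  moreover have "\<bar>f x\<bar> \<le> \<bar>f 0\<bar> + \<bar>f x - f 0\<bar>" by linarith
  ultimately show ?thesis by (simp add: algebra_simps)
qed

text \<open>
  Testing the equation against \<open>Q\<close> is the integration over the line of the derivative of
  \<open>W * Q + u' * Q' - u * Q''\<close>, where \<open>W = a * x * u - u'' + u - u powr (p + 1) + F * Q'\<close> has
  derivative \<open>- a * g * u\<close>. The boundary terms vanish because a bounded \<open>u\<close> makes \<open>W\<close> and hence
  \<open>u''\<close> grow at most linearly and \<open>u'\<close> at most quadratically, which the exponential decay of \<open>Q\<close>
  absorbs. Since \<open>Q'\<close> is in the kernel of the linearised operator, every term that is linear in
  \<open>u - Q\<close> carries an additional factor \<open>a\<close>.
\<close>

lemma soliton_projection: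
  fixes p g C e :: real
  assumes p: "p \<ge> 1" and C: "C \<ge> 0"
  obtains K where "\<And>a u u1 u2 u3 F. 0 \<le> a \<Longrightarrow> a \<le> e \<Longrightarrow>
     (\<And>x. (u has_real_derivative u1 x) (at x)) \<Longrightarrow>
     (\<And>x. (u1 has_real_derivative u2 x) (at x)) \<Longrightarrow>
     (\<And>x. (u2 has_real_derivative u3 x) (at x)) \<Longrightarrow>
     (\<And>x. 0 < u x) \<Longrightarrow> (\<And>x. \<bar>u x - Q p x\<bar> \<le> C * a) \<Longrightarrow>
     (\<And>x. a * ((1 + g) * u x + x * u1 x) - u3 x + u1 x - (p + 1) * u x powr p * u1 x
         + F * (Q p x - Q p x powr p * Q p x) = 0) \<Longrightarrow>
     \<bar>F * (\<integral>x. (Q_deriv p x)\<^sup>2 \<partial>lborel) - a * (g + 1/2) * (\<integral>x. (Q p x)\<^sup>2 \<partial>lborel)\<bar> \<le> K * a\<^sup>2"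
proof -
  have p0: "p > 0" using p by simp
  obtain L where L: "L > 0" "\<And>x. Q p x \<le> L * exp (- \<bar>x\<bar>)" using Q_le_exp[OF p0] by blast
  have L': "Q p x \<le> L" for x
    by (rule order_trans[OF L(2)]) (use L(1) in \<open>auto intro!: mult_left_le\<close>)
  note Qp = Q_pos[OF p0] and dQ = Q_has_derivative[OF p0] and dQ_deriv = Q_deriv_has_derivative[OF p0]
  define M where "M = L + C * \<bar>e\<bar>"
  define R where "R = (p + 1) * p * M powr (p - 1) * C\<^sup>2"
  define B where "B = \<bar>g\<bar> * C + C + R"
  define J where "J = integral\<^sup>L lborel (\<lambda>x::real. (1 + \<bar>x\<bar>) * exp (- \<bar>x\<bar>))"
  have LM: "L \<le> M" using C by (simp add: M_def)
  note contQ = continuous_on_Q[OF p0]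
  have intpoly: "integrable lborel (\<lambda>x::real. (1 + \<bar>x\<bar>) * exp (- \<bar>x\<bar>))"
    by (rule integrable_lborel_if_exp_bound[of _ 1]) (auto intro!: continuous_intros)
  note intQQ = integrable_soliton_sq[OF p0]
  show thesis
  proof (rule that[of "L * B * J"])
    fix a F :: real and u u1 u2 u3 :: "real \<Rightarrow> real"
    assume a: "0 \<le> a" "a \<le> e"
      and du: "\<And>x. (u has_real_derivative u1 x) (at x)"
        "\<And>x. (u1 has_real_derivative u2 x) (at x)"
        "\<And>x. (u2 has_real_derivative u3 x) (at x)"
      and pos: "\<And>x. 0 < u x" and close: "\<And>x. \<bar>u x - Q p x\<bar> \<le> C * a"
      and eq: "\<And>x. a * ((1 + g) * u x + x * u1 x) - u3 x + u1 x - (p + 1) * u x powr p * u1 x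
         + F * (Q p x - Q p x powr p * Q p x) = 0"
    have uM: "u x \<le> M" for x
    proof -
      have "C * a \<le> C * \<bar>e\<bar>" using a C by (intro mult_left_mono) auto
      then show ?thesis using close[of x] L'[of x] by (simp add: M_def)
    qed
    have M0: "M > 0" using LM L(1) by simp
    have contu: "continuous_on UNIV u" "continuous_on UNIV u1" "continuous_on UNIV u2"
      by (rule DERIV_continuous_on, rule du)+
    define Q2 where "Q2 x = Q p x - Q p x powr p * Q p x" for x
    define W where "W x = a * x * u x - u2 x + u x - u x powr (p + 1) + F * Q_deriv p x" for x
    \<comment> \<open>The last two terms turn \<open>a * x * Q * Q'\<close> into \<open>- a * Q\<^sup>2 / 2\<close> and cancel what the nonlinearity contributes for \<open>u = Q\<close>.\<close>
    define T where "T x = W x * Q p x + u1 x * Q_deriv p x - u x * Q2 x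
        - a * x * (Q p x)\<^sup>2 / 2 - p / (p + 2) * Q p x powr (p + 2)" for x
    define err where "err x = a * g * (u x - Q p x) * Q p x - a * x * (u x - Q p x) * Q_deriv p x
        + (u x powr (p + 1) - Q p x powr (p + 1) - (p + 1) * Q p x powr p * (u x - Q p x)) * Q_deriv p x" for x
    have dW: "(W has_real_derivative - a * g * u x) (at x)" for x
    proof -
      have "(W has_real_derivative a * u x + a * x * u1 x - u3 x + u1 x - (p + 1) * u x powr p * u1 x + F * Q2 x) (at x)"
        unfolding W_def[abs_def] Q2_def using pos[of x]
        by (auto intro!: derivative_eq_intros du dQ_deriv)
      moreover have "a * u x + a * x * u1 x - u3 x + u1 x - (p + 1) * u x powr p * u1 x + F * Q2 x = - a * g * u x"
        using eq[of x] by (simp add: Q2_def algebra_simps)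
      ultimately show ?thesis by simp
    qed
    have dQ2: "(Q2 has_real_derivative Q_deriv p x - (p + 1) * Q p x powr p * Q_deriv p x) (at x)" for x
    proof -
      have "(Q2 has_real_derivative Q_deriv p x - (p * Q p x powr (p - 1) * Q_deriv p x * Q p x + Q_deriv p x * Q p x powr p)) (at x)"
        unfolding Q2_def[abs_def] using Qp[of x] by (auto intro!: derivative_eq_intros dQ)
      also have "Q_deriv p x - (p * Q p x powr (p - 1) * Q_deriv p x * Q p x + Q_deriv p x * Q p x powr p)
          = Q_deriv p x - (p + 1) * Q p x powr p * Q_deriv p x"
        using Qp[of x] by (simp add: powr_diff algebra_simps)
      finally show ?thesis .
    qed
    have dT: "(T has_real_derivative F * (Q_deriv p x)\<^sup>2 - a * (g + 1/2) * (Q p x)\<^sup>2 - err x) (at x)" for x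
    proof -
      have "((\<lambda>x. Q p x powr (p + 2)) has_real_derivative (p + 2) * Q p x powr (p + 1) * Q_deriv p x) (at x)"
        using DERIV_fun_powr[OF dQ Qp[of x], of "p + 2"] by (simp add: add.commute)
      then have "(T has_real_derivative (- a * g * u x * Q p x + Q_deriv p x * W x) + (u2 x * Q_deriv p x + Q2 x * u1 x)
         - (u1 x * Q2 x + (Q_deriv p x - (p + 1) * Q p x powr p * Q_deriv p x) * u x)
         - (a * (Q p x)\<^sup>2 / 2 + a * x * Q p x * Q_deriv p x) - p / (p + 2) * ((p + 2) * Q p x powr (p + 1) * Q_deriv p x)) (at x)"
        unfolding T_def[abs_def] using Qp[of x]
        by (intro DERIV_diff DERIV_add DERIV_mult DERIV_cmult dW du dQ dQ_deriv[folded Q2_def] dQ2)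
           (auto intro!: derivative_eq_intros dQ simp: field_simps)
      moreover have "p / (p + 2) * ((p + 2) * Q p x powr (p + 1) * Q_deriv p x) = p * Q p x powr (p + 1) * Q_deriv p x"
        using p by simp
      moreover have "Q p x powr p * Q p x = Q p x powr (p + 1)" "Q p x powr p * (Q p x * y) = Q p x powr (p + 1) * y" for y
        using Qp[of x] by (simp_all add: powr_add)
      ultimately show ?thesis unfolding W_def err_def 
        by (simp add: algebra_simps power2_eq_square)
    qed
    have "\<bar>err x\<bar> \<le> a\<^sup>2 * B * L * ((1 + \<bar>x\<bar>) * exp (- \<bar>x\<bar>))" for x
    proof -
      have "\<bar>u x powr (p + 1) - Q p x powr (p + 1) - (p + 1) * Q p x powr p * (u x - Q p x)\<bar>
          \<le> (p + 1) * p * M powr (p - 1) * (u x - Q p x)\<^sup>2"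
        by (intro powr_second_order_bound p pos Qp uM order_trans[OF L' LM])
      also have "\<dots> \<le> (p + 1) * p * M powr (p - 1) * (C * a)\<^sup>2"
        using close[of x] p by (intro mult_left_mono power2_le_iff_abs_le[THEN iffD2]) (use C a in auto)
      finally have 3: "\<bar>u x powr (p + 1) - Q p x powr (p + 1) - (p + 1) * Q p x powr p * (u x - Q p x)\<bar> \<le> a\<^sup>2 * R"
        by (simp add: R_def power_mult_distrib mult_ac)
      have R: "R \<ge> 0" using p by (simp add: R_def)
      have 1: "\<bar>a * g * (u x - Q p x)\<bar> \<le> a\<^sup>2 * (\<bar>g\<bar> * C)"
      proof -
        have "\<bar>a * g * (u x - Q p x)\<bar> = a * \<bar>g\<bar> * \<bar>u x - Q p x\<bar>" using a by (simp add: abs_mult)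
        also have "\<dots> \<le> a * \<bar>g\<bar> * (C * a)" using a by (intro mult_left_mono close) auto
        finally show ?thesis by (simp add: power2_eq_square mult_ac)
      qed
      have 2: "\<bar>a * x * (u x - Q p x)\<bar> \<le> a\<^sup>2 * (\<bar>x\<bar> * C)"
      proof -
        have "\<bar>a * x * (u x - Q p x)\<bar> = a * \<bar>x\<bar> * \<bar>u x - Q p x\<bar>" using a by (simp add: abs_mult)
        also have "\<dots> \<le> a * \<bar>x\<bar> * (C * a)" using a by (intro mult_left_mono close) auto
        finally show ?thesis by (simp add: power2_eq_square mult_ac)
      qed
      have "\<bar>err x\<bar> \<le> \<bar>a * g * (u x - Q p x)\<bar> * \<bar>Q p x\<bar> + \<bar>a * x * (u x - Q p x)\<bar> * \<bar>Q_deriv p x\<bar>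
         + \<bar>u x powr (p + 1) - Q p x powr (p + 1) - (p + 1) * Q p x powr p * (u x - Q p x)\<bar> * \<bar>Q_deriv p x\<bar>"
        unfolding err_def abs_mult[symmetric] by linarith
      also have "\<dots> \<le> a\<^sup>2 * (\<bar>g\<bar> * C) * Q p x + a\<^sup>2 * (\<bar>x\<bar> * C) * Q p x + a\<^sup>2 * R * Q p x"
        using Qp[of x] C R by (intro add_mono mult_mono 1 2 3 abs_Q_deriv_le p0) auto
      also have "\<dots> = a\<^sup>2 * (\<bar>g\<bar> * C + \<bar>x\<bar> * C + R) * Q p x" by (simp add: algebra_simps)
      also have "\<dots> \<le> a\<^sup>2 * (B * (1 + \<bar>x\<bar>)) * (L * exp (- \<bar>x\<bar>))"
      proof (intro mult_mono mult_left_mono L(2))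
        have "\<bar>x\<bar> * (\<bar>g\<bar> * C + R) \<ge> 0" using C R by simp
        then show "\<bar>g\<bar> * C + \<bar>x\<bar> * C + R \<le> B * (1 + \<bar>x\<bar>)" 
          using C by (simp add: B_def algebra_simps)
      qed (use Qp[of x] C R in \<open>auto simp: B_def intro: less_imp_le\<close>)
      finally show ?thesis by (simp add: mult_ac)
    qed
    note err_le = this
    have cont_err: "continuous_on UNIV err"
      unfolding err_def[abs_def] using Qp pos
      by (intro continuous_intros contQ contu) (auto simp: less_imp_neq[symmetric])
    have int_err: "integrable lborel err"
      by (rule integrable_lborel_if_exp_bound[OF cont_err err_le])
    have limT: "(T \<longlongrightarrow> 0) at_infinity"
    proof -
      define K1 where "K1 = \<bar>W 0\<bar> + a * \<bar>g\<bar> * M"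
      define K2 where "K2 = a * M + M + M powr (p + 1) + \<bar>F\<bar> * L + K1"
      have square: "y \<le> K * (1 + \<bar>x\<bar>)\<^sup>2" if "y \<le> K * (1 + \<bar>x\<bar>)" "K \<ge> 0" for y K x :: real
      proof -
        have "K * (1 + \<bar>x\<bar>) * 1 \<le> K * (1 + \<bar>x\<bar>) * (1 + \<bar>x\<bar>)"
          using that(2) by (intro mult_left_mono) auto
        with that(1) show ?thesis by (simp add: power2_eq_square mult_ac)
      qed
      have W: "\<bar>W x\<bar> \<le> K1 * (1 + \<bar>x\<bar>)" for x
      proof -
        have "\<bar>- a * g * u y\<bar> \<le> a * \<bar>g\<bar> * M * (1 + \<bar>y\<bar>) ^ 0" for y
          using a pos[of y] uM[of y] by (simp add: abs_mult mult_left_mono)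
        from polynomial_growth_from_derivative[OF dW this, of x] show ?thesis by (simp add: K1_def)
      qed
      have K1: "K1 \<ge> 0" using a M0 by (simp add: K1_def)
      have u2: "\<bar>u2 x\<bar> \<le> K2 * (1 + \<bar>x\<bar>) ^ 1" for x
      proof -
        have "u2 x = a * x * u x + u x - u x powr (p + 1) + F * Q_deriv p x - W x" by (simp add: W_def)
        then have "\<bar>u2 x\<bar> \<le> \<bar>a * x * u x\<bar> + \<bar>u x\<bar> + \<bar>u x powr (p + 1)\<bar> + \<bar>F * Q_deriv p x\<bar> + \<bar>W x\<bar>"
          by linarith
        also have "\<dots> \<le> a * M * (1 + \<bar>x\<bar>) + M * (1 + \<bar>x\<bar>) + M powr (p + 1) * (1 + \<bar>x\<bar>)
            + \<bar>F\<bar> * L * (1 + \<bar>x\<bar>) + K1 * (1 + \<bar>x\<bar>)"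
        proof (intro add_mono W)
          have up: "\<bar>u x\<bar> \<le> M" using pos[of x] uM[of x] by simp
          have step: "y \<le> y * (1 + \<bar>x\<bar>)" if "0 \<le> y" for y :: real using that by (simp add: algebra_simps)
          show "\<bar>u x\<bar> \<le> M * (1 + \<bar>x\<bar>)" using up step[of M] M0 by linarith
          have "\<bar>a * x * u x\<bar> = a * \<bar>u x\<bar> * \<bar>x\<bar>" using a by (simp add: abs_mult)
          also have "\<dots> \<le> a * M * (1 + \<bar>x\<bar>)" using a up M0 by (intro mult_mono mult_left_mono) auto
          finally show "\<bar>a * x * u x\<bar> \<le> a * M * (1 + \<bar>x\<bar>)" .
          have "u x powr (p + 1) \<le> M powr (p + 1)" using pos[of x] uM[of x] p by (intro powr_mono2) auto
          then show "\<bar>u x powr (p + 1)\<bar> \<le> M powr (p + 1) * (1 + \<bar>x\<bar>)"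
            using step[of "M powr (p + 1)"] by simp
          have "\<bar>F * Q_deriv p x\<bar> \<le> \<bar>F\<bar> * L"
            unfolding abs_mult using abs_Q_deriv_le[OF p0, of x] L'[of x] by (intro mult_left_mono) auto
          then show "\<bar>F * Q_deriv p x\<bar> \<le> \<bar>F\<bar> * L * (1 + \<bar>x\<bar>)" using step[of "\<bar>F\<bar> * L"] L(1) by simp
        qed
        finally show ?thesis by (simp add: K2_def algebra_simps)
      qed
      have u1: "\<bar>u1 x\<bar> \<le> (\<bar>u1 0\<bar> + K2) * (1 + \<bar>x\<bar>)\<^sup>2" for x
        using polynomial_growth_from_derivative[OF du(2) u2, of x] by (simp add: numeral_2_eq_2)
      have hQ: "\<bar>Q p x\<bar> \<le> L * exp (- \<bar>x\<bar>)" "\<bar>Q_deriv p x\<bar> \<le> L * exp (- \<bar>x\<bar>)" for x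
        using L(2)[of x] Qp[of x] abs_Q_deriv_le[OF p0, of x] by linarith+
      have hQ2: "\<bar>Q2 x\<bar> \<le> ((1 + L powr p) * L) * exp (- \<bar>x\<bar>)" for x
      proof -
        have "Q p x powr p \<le> L powr p" using Qp[of x] L'[of x] p by (intro powr_mono2) auto
        then have "Q p x powr p * Q p x \<le> L powr p * Q p x" using Qp[of x] by (intro mult_right_mono) auto
        moreover have "0 \<le> Q p x powr p * Q p x" using Qp[of x] by simp
        ultimately have "\<bar>Q2 x\<bar> \<le> (1 + L powr p) * Q p x"
          unfolding Q2_def distrib_right using Qp[of x] by linarith
        also have "\<dots> \<le> (1 + L powr p) * (L * exp (- \<bar>x\<bar>))" by (intro mult_left_mono L) auto
        finally show ?thesis by (simp add: mult_ac)
      qed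
      have poly: "\<bar>a * x * Q p x / 2\<bar> \<le> a * L * (1 + \<bar>x\<bar>)\<^sup>2" "\<bar>u x\<bar> \<le> M * (1 + \<bar>x\<bar>)\<^sup>2"
          "\<bar>p / (p + 2) * Q p x powr (p + 1)\<bar> \<le> L powr (p + 1) * (1 + \<bar>x\<bar>)\<^sup>2" for x
      proof -
        have one: "y \<le> y * (1 + \<bar>x\<bar>)" if "0 \<le> y" for y :: real using that by (simp add: algebra_simps)
        have "\<bar>a * x * Q p x / 2\<bar> = a * Q p x * \<bar>x\<bar> / 2" using a Qp[of x] by (simp add: abs_mult)
        also have "\<dots> \<le> a * Q p x * \<bar>x\<bar>" using a Qp[of x] by simp
        also have "\<dots> \<le> a * L * (1 + \<bar>x\<bar>)"
          using a Qp[of x] L'[of x] L(1) by (intro mult_mono mult_left_mono) auto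
        finally show "\<bar>a * x * Q p x / 2\<bar> \<le> a * L * (1 + \<bar>x\<bar>)\<^sup>2" using a L(1) by (intro square) auto
        show "\<bar>u x\<bar> \<le> M * (1 + \<bar>x\<bar>)\<^sup>2"
        proof (rule square)
          show "\<bar>u x\<bar> \<le> M * (1 + \<bar>x\<bar>)" using pos[of x] uM[of x] M0 one[of M] by linarith
        qed (use M0 in simp)
        have "Q p x powr (p + 1) \<le> L powr (p + 1)" using Qp[of x] L'[of x] p by (intro powr_mono2) auto
        then have "p / (p + 2) * Q p x powr (p + 1) \<le> 1 * L powr (p + 1)" using p by (intro mult_mono) auto
        then have "\<bar>p / (p + 2) * Q p x powr (p + 1)\<bar> \<le> L powr (p + 1) * (1 + \<bar>x\<bar>)"
          using p one[of "L powr (p + 1)"] by (simp add: abs_mult)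
        then show "\<bar>p / (p + 2) * Q p x powr (p + 1)\<bar> \<le> L powr (p + 1) * (1 + \<bar>x\<bar>)\<^sup>2"
          by (intro square) auto
      qed
      note tends = tendsto_quadratic_times_exp_abs
      have "((\<lambda>x. W x * Q p x + u1 x * Q_deriv p x - u x * Q2 x - (a * x * Q p x / 2) * Q p x
         - (p / (p + 2) * Q p x powr (p + 1)) * Q p x) \<longlongrightarrow> 0 + 0 - 0 - 0 - 0) at_infinity"
        by (intro tendsto_diff tendsto_add tends[OF square[OF W K1] hQ(1)] tends[OF u1 hQ(2)]
            tends[OF poly(2) hQ2] tends[OF poly(1) hQ(1)] tends[OF poly(3) hQ(1)])
      moreover have "T x = W x * Q p x + u1 x * Q_deriv p x - u x * Q2 x - (a * x * Q p x / 2) * Q p x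
         - (p / (p + 2) * Q p x powr (p + 1)) * Q p x" for x
        using powr_add[of "Q p x" "p + 1" 1] Qp[of x] by (simp add: T_def power2_eq_square add.assoc)
      then have "T = (\<lambda>x. W x * Q p x + u1 x * Q_deriv p x - u x * Q2 x - (a * x * Q p x / 2) * Q p x
         - (p / (p + 2) * Q p x powr (p + 1)) * Q p x)" by (rule ext)
      ultimately show ?thesis by (simp only:) simp
    qed
    have "(\<integral>x. F * (Q_deriv p x)\<^sup>2 - a * (g + 1/2) * (Q p x)\<^sup>2 - err x \<partial>lborel) = 0 - 0"
    proof (rule lborel_integral_eq_limit_difference[OF dT])
      show "(T \<longlongrightarrow> 0) at_bot" "(T \<longlongrightarrow> 0) at_top"
        using limT at_bot_le_at_infinity at_top_le_at_infinity by (blast intro: filterlim_mono)+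
      show "continuous_on UNIV (\<lambda>x. F * (Q_deriv p x)\<^sup>2 - a * (g + 1/2) * (Q p x)\<^sup>2 - err x)"
        by (intro continuous_intros contQ cont_err)
    qed (intro Bochner_Integration.integrable_diff Bochner_Integration.integrable_mult_right intQQ int_err)
    then have "F * (\<integral>x. (Q_deriv p x)\<^sup>2 \<partial>lborel) - a * (g + 1/2) * (\<integral>x. (Q p x)\<^sup>2 \<partial>lborel) = (\<integral>x. err x \<partial>lborel)"
      by (simp add: intQQ int_err)
    also have "\<bar>\<dots>\<bar> \<le> (\<integral>x. a\<^sup>2 * B * L * ((1 + \<bar>x\<bar>) * exp (- \<bar>x\<bar>)) \<partial>lborel)"
      using err_le int_err by (intro integral_abs_bound[THEN order_trans] integral_mono integrable_abs integrable_mult_right intpoly)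
    also have "\<dots> = L * B * J * a\<^sup>2"
      unfolding integral_mult_right_zero J_def[symmetric] by (simp add: mult_ac)
    finally show "\<bar>F * (\<integral>x. (Q_deriv p x)\<^sup>2 \<partial>lborel) - a * (g + 1/2) * (\<integral>x. (Q p x)\<^sup>2 \<partial>lborel)\<bar> \<le> L * B * J * a\<^sup>2" .
  qed
qed

section \<open>Branches of zeros through a boundary face\<close>

text \<open>
  On the face \<open>a = 0\<close> the function is \<open>\<kappa> p * (y - y0)\<close>. Compactness of the parameter set gives a
  strip around \<open>y = y0\<close> on which the \<open>y\<close>-derivative stays positive, hence exactly one zero there
  for each \<open>(a, p)\<close> with small \<open>a\<close>. All of these lie in the inner half of the strip, so that a path
  of zeros starting at \<open>y0\<close> cannot leave it.
\<close>

lemma smooth_zero_branch: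
  fixes G :: "(real \<times> 'p::euclidean_space) \<times> real \<Rightarrow> real"
  assumes e: "e > 0" and r: "r > 0" and P: "compact P" "coordinate_perfect P"
    and G: "smooth_on (({0..<e} \<times> P) \<times> {y0 - r<..<y0 + r}) G"
    and face: "\<And>p y. p \<in> P \<Longrightarrow> \<bar>y - y0\<bar> < r \<Longrightarrow> G ((0, p), y) = \<kappa> p * (y - y0)"
    and \<kappa>: "\<And>p. p \<in> P \<Longrightarrow> \<kappa> p > 0"
  obtains \<epsilon> g where "0 < \<epsilon>" "\<epsilon> \<le> e" "smooth_on ({0..<\<epsilon>} \<times> P) g"
    and "\<And>z. z \<in> {0..<\<epsilon>} \<times> P \<Longrightarrow> \<bar>g z - y0\<bar> < r \<and> G (z, g z) = 0"
    and "\<And>p. p \<in> P \<Longrightarrow> g (0, p) = y0"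
    and "\<And>a c \<pi>. a \<in> {0..<\<epsilon>} \<Longrightarrow> continuous_on {0..a} c \<Longrightarrow> c 0 = y0 \<Longrightarrow>
           (\<And>t. t \<in> {0<..a} \<Longrightarrow> \<pi> t \<in> P \<and> G ((t, \<pi> t), c t) = 0) \<Longrightarrow> \<pi> a \<in> P \<Longrightarrow> c a = g (a, \<pi> a)"
proof -
  define I where "I = {y0 - r<..<y0 + r}"
  define S where "S = ({0..<e} \<times> P) \<times> I"
  define H where "H x = frechet_derivative G (at x within S) (0, 1)" for x
  have perf: "coordinate_perfect (({0..<e'} \<times> P) \<times> I)" if "0 < e'" for e' :: real
    unfolding I_def using that r P(2)
    by (intro coordinate_perfect_Times coordinate_perfect_interval[of "{0..<e'}" 0 "e'/2"]
         coordinate_perfect_interval[of "{y0 - r<..<y0 + r}" y0 "y0 + r/2"])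
       (auto simp: is_interval_def)
  have G': "smooth_on S G" using G by (simp add: S_def I_def)
  have contG: "continuous_on S G" by (rule smooth_on_continuous[OF G'])
  have contH: "continuous_on S H"
    unfolding H_def by (intro smooth_on_continuous smooth_on_partial G' perf[OF e, folded S_def])
      (simp add: Basis_prod_def)
  have dG: "((\<lambda>y. G (z, y)) has_real_derivative H (z, y)) (at y)"
    if z: "z \<in> {0..<e} \<times> P" and y: "y \<in> I" for z y
  proof -
    let ?D = "frechet_derivative G (at (z, y) within S)"
    have "(z, y) \<in> S" using z y by (simp add: S_def)
    have "((\<lambda>y. G (z, y)) has_derivative (\<lambda>h. ?D (0, h))) (at y within I)"
      by (rule has_derivative_in_compose2[OF smooth_on_has_derivative[OF G'] _ y])
         (use z in \<open>auto intro!: derivative_eq_intros simp: S_def\<close>)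
    moreover have "?D (0, h) = H (z, y) * h" for h
    proof -
      have "linear ?D" using smooth_on_has_derivative[OF G' \<open>(z, y) \<in> S\<close>] has_derivative_linear by blast
      from linear_scale[OF this, of h "(0, 1)"] show ?thesis by (simp add: H_def mult.commute)
    qed
    moreover have "at y within I = at y" using y by (intro at_within_open) (auto simp: I_def)
    ultimately show ?thesis by (simp add: has_field_derivative_def)
  qed
  have H0: "H ((0, p), y0) = \<kappa> p" if p: "p \<in> P" for p
  proof -
    have "((\<lambda>y. \<kappa> p * (y - y0)) has_real_derivative \<kappa> p) (at y0)"
      by (auto intro!: derivative_eq_intros)
    then have "((\<lambda>y. G ((0, p), y)) has_real_derivative \<kappa> p) (at y0)"
    proof (rule has_field_derivative_transform_within_open)
      show "y0 \<in> I" using r by (simp add: I_def)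
    qed (use face[OF p] in \<open>auto simp: I_def\<close>)
    moreover have "((\<lambda>y. G ((0, p), y)) has_real_derivative H ((0, p), y0)) (at y0)"
      using p e r by (intro dG) (auto simp: I_def)
    ultimately show ?thesis using DERIV_unique by blast
  qed
  have "\<exists>m>0. \<forall>p\<in>P. m \<le> \<kappa> p"
  proof (cases "P = {}")
    case False
    have "continuous_on P (\<lambda>p. H ((0, p), y0))"
      by (rule continuous_on_compose2[OF contH])
         (use e r in \<open>auto intro!: continuous_intros simp: S_def I_def\<close>)
    then have "continuous_on P \<kappa>" by (rule continuous_on_eq) (simp add: H0)
    then obtain p0 where "p0 \<in> P" "\<forall>p\<in>P. \<kappa> p0 \<le> \<kappa> p"
      using continuous_attains_inf[OF P(1) False] by blast
    with \<kappa> show ?thesis by blast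
  qed (auto intro: exI[of _ 1])
  then obtain m where m: "m > 0" "\<And>p. p \<in> P \<Longrightarrow> m \<le> \<kappa> p" by blast
  define K where "K = ({0..e/2} \<times> P) \<times> {y0 - r/2..y0 + r/2}"
  have K: "compact K" "K \<subseteq> S"
    using P(1) e r by (auto simp: K_def S_def I_def intro!: compact_Times)
  have "uniformly_continuous_on K H" "uniformly_continuous_on K G"
    by (rule compact_uniformly_continuous[OF continuous_on_subset[OF contH K(2)] K(1)],
        rule compact_uniformly_continuous[OF continuous_on_subset[OF contG K(2)] K(1)])
  then have unif: "\<exists>d>0. \<forall>x\<in>K. \<forall>x'\<in>K. dist x' x < d \<longrightarrow> dist (f x') (f x) < \<eta>"
    if "f \<in> {H, G}" "\<eta> > 0" for f \<eta>
    using that unfolding uniformly_continuous_on_def by blast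
  from unif[of H "m / 2"] obtain d where d: "d > 0"
    "\<And>x x'. x \<in> K \<Longrightarrow> x' \<in> K \<Longrightarrow> dist x' x < d \<Longrightarrow> dist (H x') (H x) < m / 2"
    using m by auto
  define \<delta> where "\<delta> = min (r / 2) (d / 2)"
  have \<delta>: "0 < \<delta>" "\<delta> \<le> r / 2" "\<delta> \<le> d / 2" "\<delta> < r" using r d by (auto simp: \<delta>_def)
  from unif[of G "m * \<delta> / 4"] obtain d' where d': "d' > 0"
    "\<And>x x'. x \<in> K \<Longrightarrow> x' \<in> K \<Longrightarrow> dist x' x < d' \<Longrightarrow> dist (G x') (G x) < m * \<delta> / 4"
    using m \<delta> by auto
  define \<epsilon> where "\<epsilon> = min (e / 2) (min (d / 2) d')"
  have \<epsilon>: "0 < \<epsilon>" "\<epsilon> \<le> e / 2" "\<epsilon> \<le> d / 2" "\<epsilon> \<le> d'" using e d d' by (auto simp: \<epsilon>_def)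
  have inI: "y \<in> I" if "\<bar>y - y0\<bar> \<le> \<delta>" for y using that \<delta> by (auto simp: I_def)
  have inK: "((a, p), y) \<in> K" if "a \<in> {0..<\<epsilon>}" "p \<in> P" "\<bar>y - y0\<bar> \<le> \<delta>" for a p y
    using that \<epsilon> \<delta> by (auto simp: K_def abs_le_iff)
  have steep: "H ((a, p), y) \<ge> m / 2" if "a \<in> {0..<\<epsilon>}" "p \<in> P" "\<bar>y - y0\<bar> \<le> \<delta>" for a p y
  proof -
    have "dist ((a, p), y) ((0, p), y0) \<le> \<bar>a\<bar> + \<bar>y - y0\<bar>"
      using norm_Pair_le[of "(a, p) - (0, p)" "y - y0"] norm_Pair_le[of "a" "p - p"]
      by (simp add: dist_norm)
    also have "\<dots> < d" using that \<epsilon> \<delta> by auto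
    finally have "dist (H ((a, p), y)) (H ((0, p), y0)) < m / 2"
      using inK[OF that] inK[of 0 p y0] that \<epsilon> \<delta> by (intro d(2)) auto
    then have "\<bar>H ((a, p), y) - \<kappa> p\<bar> < m / 2" unfolding dist_real_def H0[OF that(2)] .
    then show ?thesis using m(2)[OF that(2)] by linarith
  qed
  have mono: "m / 2 * (y2 - y1) \<le> G ((a, p), y2) - G ((a, p), y1)"
    if "a \<in> {0..<\<epsilon>}" "p \<in> P" "\<bar>y1 - y0\<bar> \<le> \<delta>" "\<bar>y2 - y0\<bar> \<le> \<delta>" "y1 < y2" for a p y1 y2
  proof -
    have "\<exists>y>y1. y < y2 \<and> G ((a, p), y2) - G ((a, p), y1) = (y2 - y1) * H ((a, p), y)"
      using that \<epsilon> e by (intro MVT2 dG inI) auto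
    then obtain y where y: "y1 < y" "y < y2" "G ((a, p), y2) - G ((a, p), y1) = (y2 - y1) * H ((a, p), y)"
      by blast
    have "H ((a, p), y) \<ge> m / 2" using that y by (intro steep) auto
    then have "m / 2 * (y2 - y1) \<le> H ((a, p), y) * (y2 - y1)" using that(5) by (intro mult_right_mono) auto
    then show ?thesis unfolding y(3) by (simp add: mult.commute)
  qed
  have expand: "m / 2 * \<bar>y2 - y1\<bar> \<le> \<bar>G ((a, p), y2) - G ((a, p), y1)\<bar>"
    if "a \<in> {0..<\<epsilon>}" "p \<in> P" "\<bar>y1 - y0\<bar> \<le> \<delta>" "\<bar>y2 - y0\<bar> \<le> \<delta>" for a p y1 y2
  proof (cases y1 y2 rule: linorder_cases)
    case less
    with mono[OF that less] show ?thesis by (simp only: abs_of_pos diff_gt_0_iff_gt)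
  next
    case greater
    with mono[OF that(1,2,4,3) greater] show ?thesis
      unfolding abs_minus_commute[of y2] by (simp only: abs_of_pos diff_gt_0_iff_gt)
  qed simp
  have uniq: "y2 = y1"
    if "a \<in> {0..<\<epsilon>}" "p \<in> P" "\<bar>y1 - y0\<bar> \<le> \<delta>" "\<bar>y2 - y0\<bar> \<le> \<delta>" "G ((a, p), y1) = 0" "G ((a, p), y2) = 0"
    for a p y1 y2
  proof -
    have "m / 2 * \<bar>y2 - y1\<bar> \<le> 0" using expand[OF that(1-4)] that(5,6) by simp
    then show ?thesis using m(1) by (simp add: mult_le_0_iff)
  qed
  have "\<exists>y. \<bar>y - y0\<bar> \<le> \<delta> / 2 \<and> G ((a, p), y) = 0" if ap: "a \<in> {0..<\<epsilon>}" "p \<in> P" for a p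
  proof -
    have near: "\<bar>G ((a, p), y) - \<kappa> p * (y - y0)\<bar> < m * \<delta> / 4" if "\<bar>y - y0\<bar> \<le> \<delta>" for y
    proof -
      have "dist ((a, p), y) ((0, p), y) \<le> \<bar>a\<bar>"
        using norm_Pair_le[of "(a, p) - (0, p)" "y - y"] norm_Pair_le[of "a" "p - p"]
        by (simp add: dist_norm)
      also have "\<dots> < d'" using ap \<epsilon> by auto
      finally have "dist (G ((a, p), y)) (G ((0, p), y)) < m * \<delta> / 4"
        using inK[OF ap that] inK[of 0 p y] ap \<epsilon> that by (intro d'(2)) auto
      then show ?thesis using face[OF ap(2), of y] that \<delta> by (simp add: dist_real_def)
    qed
    have \<kappa>\<delta>: "m * \<delta> / 2 \<le> \<kappa> p * (\<delta> / 2)" using m(2)[OF ap(2)] \<delta>(1) by simp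
    have m\<delta>: "m * \<delta> > 0" using m \<delta> by simp
    have "\<bar>G ((a, p), y0 - \<delta> / 2) + \<kappa> p * (\<delta> / 2)\<bar> < m * \<delta> / 4"
        "\<bar>G ((a, p), y0 + \<delta> / 2) - \<kappa> p * (\<delta> / 2)\<bar> < m * \<delta> / 4"
      using near[of "y0 - \<delta> / 2"] near[of "y0 + \<delta> / 2"] \<delta>(1) by simp_all
    then have "G ((a, p), y0 - \<delta> / 2) \<le> 0" "0 \<le> G ((a, p), y0 + \<delta> / 2)"
      using \<kappa>\<delta> m\<delta> by linarith+
    moreover have "continuous_on {y0 - \<delta> / 2..y0 + \<delta> / 2} (\<lambda>y. G ((a, p), y))"
      by (rule continuous_on_compose2[OF contG])
         (use ap \<epsilon> \<delta> in \<open>auto intro!: continuous_intros inI simp: S_def abs_le_iff\<close>)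
    ultimately obtain y where "y0 - \<delta> / 2 \<le> y" "y \<le> y0 + \<delta> / 2" "G ((a, p), y) = 0"
      using IVT'[of "\<lambda>y. G ((a, p), y)" "y0 - \<delta> / 2" 0 "y0 + \<delta> / 2"] \<delta> by auto
    moreover from this have "\<bar>y - y0\<bar> \<le> \<delta> / 2" by linarith
    ultimately show ?thesis by blast
  qed
  then obtain g' where g': "\<And>a p. a \<in> {0..<\<epsilon>} \<Longrightarrow> p \<in> P \<Longrightarrow> \<bar>g' a p - y0\<bar> \<le> \<delta> / 2 \<and> G ((a, p), g' a p) = 0"
    by metis
  define g where "g z = g' (fst z) (snd z)" for z
  have g: "\<bar>g (a, p) - y0\<bar> \<le> \<delta> / 2" "\<bar>g (a, p) - y0\<bar> \<le> \<delta>" "G ((a, p), g (a, p)) = 0"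
    if "a \<in> {0..<\<epsilon>}" "p \<in> P" for a p
    using g'[OF that] \<delta> by (auto simp: g_def)
  let ?Z = "{0..<\<epsilon>} \<times> P"
  have sub: "?Z \<times> I \<subseteq> S" using \<epsilon> e by (auto simp: S_def)
  have contg: "continuous_on ?Z g"
    unfolding continuous_on_iff
  proof (intro ballI allI impI)
    fix z :: "real \<times> 'p" and \<eta> :: real assume z: "z \<in> ?Z" and "\<eta> > 0"
    obtain a p where ap: "z = (a, p)" "a \<in> {0..<\<epsilon>}" "p \<in> P" using z by blast
    have "continuous_on ?Z (\<lambda>z'. G (z', g z))"
      by (rule continuous_on_compose2[OF contG])
         (use sub inI g(2)[OF ap(2,3)] ap(1) in \<open>auto intro!: continuous_intros\<close>)
    then obtain d where "d > 0" and d: "\<And>z'. z' \<in> ?Z \<Longrightarrow> dist z' z < d \<Longrightarrow>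
        dist (G (z', g z)) (G (z, g z)) < m / 2 * \<eta>"
      using z \<open>\<eta> > 0\<close> m(1) unfolding continuous_on_iff by (metis half_gt_zero mult_pos_pos)
    have "dist (g z') (g z) < \<eta>" if z': "z' \<in> ?Z" "dist z' z < d" for z'
    proof -
      obtain a' p' where ap': "z' = (a', p')" "a' \<in> {0..<\<epsilon>}" "p' \<in> P" using z' by blast
      have "m / 2 * \<bar>g z' - g z\<bar> \<le> \<bar>G (z', g z') - G (z', g z)\<bar>"
        unfolding ap'(1) using g[OF ap'(2,3)] g[OF ap(2,3)] ap(1) by (intro expand ap') auto
      also have "\<dots> < m / 2 * \<eta>"
        using d[OF z'] g(3)[OF ap'(2,3)] g(3)[OF ap(2,3)] ap(1) ap'(1) by (simp add: dist_real_def)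
      finally show ?thesis using m(1) by (simp add: dist_real_def)
    qed
    with \<open>d > 0\<close> show "\<exists>d>0. \<forall>z'\<in>?Z. dist z' z < d \<longrightarrow> dist (g z') (g z) < \<eta>" by blast
  qed
  have smoothg: "smooth_on ?Z g"
  proof (rule smooth_on_implicit[OF smooth_on_subset[OF G' sub] perf[OF \<epsilon>(1)] _ contg])
    fix z assume "z \<in> ?Z"
    then obtain a p where ap: "z = (a, p)" "a \<in> {0..<\<epsilon>}" "p \<in> P" by blast
    have "(z, g z) \<in> ?Z \<times> I" using ap inI g(2) by auto
    then have "frechet_derivative G (at (z, g z) within ?Z \<times> I) (0, 1) = H (z, g z)"
      unfolding H_def using frechet_derivative_within_subset[OF G' sub perf[OF \<epsilon>(1)]] by simp
    moreover have "H (z, g z) \<ge> m / 2" unfolding ap(1) using ap g(2) by (intro steep) auto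
    ultimately show "frechet_derivative G (at (z, g z) within ?Z \<times> I) (0, 1) \<noteq> 0" using m(1) by simp
  qed (use g inI in auto)
  have g0: "g (0, p) = y0" if "p \<in> P" for p
    using uniq[of 0 p y0 "g (0, p)"] that \<epsilon> \<delta> g[of 0 p] face[of p y0] r by simp
  show thesis
  proof (rule that[of \<epsilon> g])
    show "\<bar>g z - y0\<bar> < r \<and> G (z, g z) = 0" if z: "z \<in> ?Z" for z
    proof -
      obtain a p where "z = (a, p)" "a \<in> {0..<\<epsilon>}" "p \<in> P" using z by blast
      then show ?thesis using g[of a p] \<delta>(4) by auto
    qed
    fix a c \<pi>
    assume a: "a \<in> {0..<\<epsilon>}" and c: "continuous_on {0..a} c" "c 0 = y0"
      and zero: "\<And>t. t \<in> {0<..a} \<Longrightarrow> \<pi> t \<in> P \<and> G ((t, \<pi> t), c t) = 0" and \<pi>: "\<pi> a \<in> P"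
    show "c a = g (a, \<pi> a)"
    proof (cases "a = 0")
      case True
      then show ?thesis using c g0 \<pi> by simp
    next
      case False
      have eq: "c t = g (t, \<pi> t)" if "t \<in> {0<..a}" "\<bar>c t - y0\<bar> \<le> \<delta>" for t
      proof (rule uniq)
        show t: "t \<in> {0..<\<epsilon>}" using that(1) a by simp
        show p: "\<pi> t \<in> P" using zero[OF that(1)] by simp
        show "G ((t, \<pi> t), c t) = 0" using zero[OF that(1)] by simp
        show "\<bar>g (t, \<pi> t) - y0\<bar> \<le> \<delta>" "G ((t, \<pi> t), g (t, \<pi> t)) = 0" by (fact g(2,3)[OF t p])+
        show "\<bar>c t - y0\<bar> \<le> \<delta>" by (fact that(2))
      qed
      have "\<bar>c a - y0\<bar> \<le> \<delta>"
      proof (rule ccontr)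
        \<comment> \<open>On its way out the path meets distance exactly \<open>\<delta>\<close>, where uniqueness still holds.\<close>
        assume "\<not> ?thesis"
        moreover have "continuous_on {0..a} (\<lambda>t. \<bar>c t - y0\<bar>)" using c by (intro continuous_intros)
        ultimately obtain t where t: "0 \<le> t" "t \<le> a" "\<bar>c t - y0\<bar> = \<delta>"
          using IVT'[of "\<lambda>t. \<bar>c t - y0\<bar>" 0 \<delta> a] c(2) \<delta>(1) a by auto
        have "t \<noteq> 0" using t(3) c(2) \<delta>(1) by auto
        then have "c t = g (t, \<pi> t)" "\<pi> t \<in> P" using t eq[of t] zero[of t] by auto
        then show False using g(1)[of t "\<pi> t"] t a \<delta>(1) by auto
      qed
      then show ?thesis using eq[of a] False a by auto
    qed
  qed (use \<epsilon> e smoothg g0 in auto)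
qed

section \<open>The family of profiles\<close>

locale profiles =
  fixes q \<epsilon>0 :: real and u :: "real \<Rightarrow> real \<Rightarrow> real \<Rightarrow> real \<Rightarrow> real"
  assumes q: "q > 4" and \<epsilon>0: "\<epsilon>0 > 0" and family: "profile_family \<epsilon>0 q u"
begin

abbreviation "S4 \<equiv> {0..<\<epsilon>0} \<times> gamma_range \<epsilon>0 \<times> {3..q} \<times> (UNIV :: real set)"
abbreviation "S3 \<equiv> {0..<\<epsilon>0} \<times> gamma_range \<epsilon>0 \<times> {3..q}"

definition dx :: "(real \<times> real \<times> real \<times> real \<Rightarrow> real) \<Rightarrow> real \<times> real \<times> real \<times> real \<Rightarrow> real" where
  "dx f z = frechet_derivative f (at z within S4) (0, 0, 0, 1)"

text \<open>
  The \<open>x\<close>-derivatives of the profiles, kept as functions of all four variables, so that their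
  values at a fixed \<open>x\<close> are smooth in the parameters.
\<close>

definition U :: "nat \<Rightarrow> real \<times> real \<times> real \<times> real \<Rightarrow> real" where
  "U n = (dx ^^ n) (\<lambda>(a, \<gamma>, p, x). u a \<gamma> p x)"

lemma gamma_range_eq: "gamma_range \<epsilon>0 = {- 1/2 - \<epsilon>0<..<- 1/2 + \<epsilon>0}"
  by (auto simp: gamma_range_def abs_less_iff)

lemma perfect_factors:
  "coordinate_perfect {0..<\<epsilon>0}" "coordinate_perfect (gamma_range \<epsilon>0)" "coordinate_perfect {3..q}"
  "coordinate_perfect (UNIV :: real set)"
proof -
  show "coordinate_perfect {0..<\<epsilon>0}"
    by (rule coordinate_perfect_interval[of _ 0 "\<epsilon>0 / 2"]) (use \<epsilon>0 in \<open>auto simp: is_interval_def\<close>)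
  show "coordinate_perfect (gamma_range \<epsilon>0)"
    by (rule coordinate_perfect_interval[of _ "- 1/2" "- 1/2 + \<epsilon>0 / 2"])
       (use \<epsilon>0 in \<open>auto simp: is_interval_def gamma_range_eq\<close>)
  show "coordinate_perfect {3..q}"
    by (rule coordinate_perfect_interval[of _ 3 4]) (use q in \<open>auto simp: is_interval_def\<close>)
  show "coordinate_perfect (UNIV :: real set)"
    by (rule coordinate_perfect_interval[of _ 0 1]) (auto simp: is_interval_def)
qed

lemma smooth_on_dx: "smooth_on S4 f \<Longrightarrow> smooth_on S4 (dx f)"
  unfolding dx_def
  by (intro smooth_on_partial coordinate_perfect_Times perfect_factors) (simp_all add: Basis_prod_def)

lemma has_derivative_dx:
  assumes f: "smooth_on S4 f" and z: "a \<in> {0..<\<epsilon>0}" "\<gamma> \<in> gamma_range \<epsilon>0" "p \<in> {3..q}"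
  shows "((\<lambda>x. f (a, \<gamma>, p, x)) has_real_derivative dx f (a, \<gamma>, p, x)) (at x)"
proof -
  let ?D = "frechet_derivative f (at (a, \<gamma>, p, x) within S4)"
  have in_S: "(a, \<gamma>, p, x) \<in> S4" using z by simp
  have "((\<lambda>x. f (a, \<gamma>, p, x)) has_derivative (\<lambda>h. ?D (0, 0, 0, h))) (at x within UNIV)"
    by (rule has_derivative_in_compose2[OF smooth_on_has_derivative[OF f]])
       (use z in \<open>auto intro!: derivative_eq_intros\<close>)
  moreover have "?D (0, 0, 0, h) = dx f (a, \<gamma>, p, x) * h" for h
  proof -
    have "linear ?D" using smooth_on_has_derivative[OF f in_S] by (rule has_derivative_linear)
    from linear_scale[OF this, of h "(0, 0, 0, 1)"] show ?thesis by (simp add: dx_def mult.commute)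
  qed
  ultimately show ?thesis by (simp add: has_field_derivative_def)
qed

lemma smooth_on_U: "smooth_on S4 (U n)"
  using family smooth_on_dx by (induction n) (auto simp: U_def profile_family_def)

lemma U_0: "U 0 (a, \<gamma>, p, x) = u a \<gamma> p x"
  by (simp add: U_def)

context
  fixes a \<gamma> p :: real
  assumes params: "a \<in> {0..<\<epsilon>0}" "\<gamma> \<in> gamma_range \<epsilon>0" "p \<in> {3..q}"
begin

lemma has_derivative_U:
  "((\<lambda>x. U n (a, \<gamma>, p, x)) has_real_derivative U (Suc n) (a, \<gamma>, p, x)) (at x)"
  using has_derivative_dx[OF smooth_on_U params] by (simp add: U_def)

lemma deriv_u: "(deriv ^^ n) (u a \<gamma> p) x = U n (a, \<gamma>, p, x)"
proof (induction n arbitrary: x)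
  case (Suc n)
  then have "(deriv ^^ n) (u a \<gamma> p) = (\<lambda>x. U n (a, \<gamma>, p, x))" by (rule ext)
  then show ?case using DERIV_imp_deriv[OF has_derivative_U[of n x]] by simp
qed (simp add: U_0)

lemma deriv_u_once: "deriv (u a \<gamma> p) x = U (Suc 0) (a, \<gamma>, p, x)"
  using deriv_u[of 1 x] by simp

lemma u_pos: "0 < u a \<gamma> p x"
  using family params unfolding profile_family_def by blast

lemma nonlinearity_has_derivative:
  "((\<lambda>x. \<bar>u a \<gamma> p x\<bar> powr p * u a \<gamma> p x) has_real_derivative
     (p + 1) * u a \<gamma> p x powr p * U 1 (a, \<gamma>, p, x)) (at x)"
proof -
  have "((\<lambda>x. u a \<gamma> p x) has_real_derivative U 1 (a, \<gamma>, p, x)) (at x)"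
    using has_derivative_U[of 0 x] by (simp add: U_0)
  from DERIV_fun_powr[OF this u_pos, of "p + 1"]
  have "((\<lambda>x. u a \<gamma> p x powr (p + 1)) has_real_derivative
     (p + 1) * u a \<gamma> p x powr p * U 1 (a, \<gamma>, p, x)) (at x)" by simp
  moreover have "\<bar>u a \<gamma> p x\<bar> powr p * u a \<gamma> p x = u a \<gamma> p x powr (p + 1)" for x
    using u_pos[of x] by (simp add: powr_add)
  ultimately show ?thesis by simp
qed

lemma profile_op_eq:
  "profile_op a b p (u a \<gamma> p) x = a * (b * U 0 (a, \<gamma>, p, x) + x * U 1 (a, \<gamma>, p, x))
     - U 3 (a, \<gamma>, p, x) + U 1 (a, \<gamma>, p, x) - (p + 1) * U 0 (a, \<gamma>, p, x) powr p * U 1 (a, \<gamma>, p, x)"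
  unfolding profile_op_def deriv_u DERIV_imp_deriv[OF nonlinearity_has_derivative]
  by (simp add: U_0 deriv_u_once)

lemma divergence_form_eq:
  "a * (b * u a \<gamma> p x + x * deriv (u a \<gamma> p) x)
     - deriv (\<lambda>y. (deriv ^^ 2) (u a \<gamma> p) y - u a \<gamma> p y + \<bar>u a \<gamma> p y\<bar> powr p * u a \<gamma> p y) x
   = profile_op a b p (u a \<gamma> p) x"
proof -
  have "((\<lambda>y. U 2 (a, \<gamma>, p, y) - U 0 (a, \<gamma>, p, y) + \<bar>u a \<gamma> p y\<bar> powr p * u a \<gamma> p y) has_real_derivative
     U (Suc 2) (a, \<gamma>, p, x) - U (Suc 0) (a, \<gamma>, p, x) + (p + 1) * u a \<gamma> p x powr p * U 1 (a, \<gamma>, p, x)) (at x)"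
    by (intro DERIV_add DERIV_diff has_derivative_U nonlinearity_has_derivative)
  from DERIV_imp_deriv[OF this] show ?thesis
    unfolding profile_op_eq deriv_u deriv_u_once by (simp add: U_0 numeral_2_eq_2 numeral_3_eq_3)
qed

end

text \<open>
  The obstruction \<open>\<langle>Q', u\<rangle>\<close> multiplies \<open>Q''\<close> in the equation, so it is read off at the single point
  \<open>x = 0\<close>, where \<open>Q''\<close> does not vanish. This makes it a smooth function of the parameters without
  differentiating the integral over the line that defines it.
\<close>

definition \<Phi> :: "real \<times> real \<times> real \<Rightarrow> real" where
  "\<Phi> = (\<lambda>(a, \<gamma>, p). profile_op a (1 + \<gamma>) p (u a \<gamma> p) 0)"

definition F :: "real \<times> real \<times> real \<Rightarrow> real" where
  "F = (\<lambda>(a, \<gamma>, p). inner_L2 (deriv (Q p)) (u a \<gamma> p))"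

lemma profile_equation:
  assumes "(a, \<gamma>, p) \<in> S3"
  shows "profile_op a (1 + \<gamma>) p (u a \<gamma> p) x + F (a, \<gamma>, p) * (Q p x - Q p x powr p * Q p x) = 0"
proof -
  have par: "a \<in> {0..<\<epsilon>0}" "\<gamma> \<in> gamma_range \<epsilon>0" "p \<in> {3..q}" using assms by auto
  have "\<forall>a\<in>{0..<\<epsilon>0}. \<forall>\<gamma>\<in>gamma_range \<epsilon>0. \<forall>p\<in>{3..q}. \<forall>x.
      profile_op a (1 + \<gamma>) p (u a \<gamma> p) x + inner_L2 (deriv (Q p)) (u a \<gamma> p) * (deriv ^^ 2) (Q p) x = 0"
    using family unfolding profile_family_def by (elim conjE)
  with par have "profile_op a (1 + \<gamma>) p (u a \<gamma> p) x + inner_L2 (deriv (Q p)) (u a \<gamma> p) * (deriv ^^ 2) (Q p) x = 0"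
    by blast
  then show ?thesis using assms deriv2_Q[of p x] by (simp add: F_def)
qed

lemma \<Phi>_eq_F:
  assumes "(a, \<gamma>, p) \<in> S3"
  shows "\<Phi> (a, \<gamma>, p) = F (a, \<gamma>, p) * (p / 2 * Q p 0)"
proof -
  have "Q p 0 - Q p 0 powr p * Q p 0 = - (p / 2 * Q p 0)"
    using Q_0[of p] assms by (simp add: field_simps)
  then show ?thesis using profile_equation[OF assms, of 0] by (simp add: \<Phi>_def)
qed

lemma \<Phi>_eq_0_iff:
  assumes "(a, \<gamma>, p) \<in> S3"
  shows "\<Phi> (a, \<gamma>, p) = 0 \<longleftrightarrow> (\<forall>x. profile_op a (1 + \<gamma>) p (u a \<gamma> p) x = 0)"
proof
  assume "\<Phi> (a, \<gamma>, p) = 0"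
  then have "F (a, \<gamma>, p) = 0" using \<Phi>_eq_F[OF assms] Q_pos[of p 0] assms by simp
  then show "\<forall>x. profile_op a (1 + \<gamma>) p (u a \<gamma> p) x = 0"
    using profile_equation[OF assms] by simp
qed (simp add: \<Phi>_def)

lemma smooth_on_\<Phi>: "smooth_on S3 \<Phi>"
proof -
  have at_0: "smooth_on S3 (\<lambda>z. U n (fst z, fst (snd z), snd (snd z), 0))" for n
    by (rule smooth_on_compose_linear[OF smooth_on_U]) (auto intro!: bounded_linear_euclideanI)
  have proj: "smooth_on S3 (\<lambda>z. fst z)" "smooth_on S3 (\<lambda>z. fst (snd z))" "smooth_on S3 (\<lambda>z. snd (snd z))"
    by (auto intro!: smooth_on_bounded_linear bounded_linear_euclideanI)
  have pos: "0 < U 0 (fst z, fst (snd z), snd (snd z), 0)" if "z \<in> S3" for z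
    using that u_pos by (auto simp: U_0)
  have "smooth_on S3 (\<lambda>z. fst z * ((1 + fst (snd z)) * U 0 (fst z, fst (snd z), snd (snd z), 0))
      - U 3 (fst z, fst (snd z), snd (snd z), 0) + U 1 (fst z, fst (snd z), snd (snd z), 0)
      - (snd (snd z) + 1) * U 0 (fst z, fst (snd z), snd (snd z), 0) powr snd (snd z) *
          U 1 (fst z, fst (snd z), snd (snd z), 0))"
    by (intro smooth_on_add smooth_on_diff smooth_on_mult smooth_on_const smooth_on_powr at_0 proj pos)
  also have "?this \<longleftrightarrow> smooth_on S3 \<Phi>"
    by (rule smooth_on_cong) (auto simp: \<Phi>_def profile_op_eq)
  finally show ?thesis .
qed

text \<open>
  The mean value theorem in \<open>a\<close> from \<open>a = 0\<close>, where the profile is the soliton; the bound on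
  the first \<open>a\<close>-derivative of the family is uniform in \<open>x\<close> and in the parameters.
\<close>

lemma close_to_soliton:
  obtains C where "C \<ge> 0" and
    "\<And>a \<gamma> p x. (a, \<gamma>, p) \<in> S3 \<Longrightarrow> \<bar>u a \<gamma> p x - Q p x\<bar> \<le> C * a"
proof -
  have "\<forall>k\<ge>1. \<forall>n m. \<exists>C. \<forall>a\<in>{0..<\<epsilon>0}. \<forall>\<gamma>\<in>gamma_range \<epsilon>0. \<forall>p\<in>{3..q}. \<forall>x.
        (1 + max x 0) powr (1 - real k) *
        \<bar>nth_deriv_within (gamma_range \<epsilon>0) n
           (\<lambda>\<gamma>'. nth_deriv_within {3..q} m
             (\<lambda>p'. nth_deriv_within {0..<\<epsilon>0} k (\<lambda>a'. u a' \<gamma>' p' x) a) p) \<gamma>\<bar> \<le> C"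
    using family unfolding profile_family_def by blast
  then obtain C where bound: "\<forall>a\<in>{0..<\<epsilon>0}. \<forall>\<gamma>\<in>gamma_range \<epsilon>0. \<forall>p\<in>{3..q}. \<forall>x.
        (1 + max x 0) powr (1 - real 1) *
        \<bar>nth_deriv_within (gamma_range \<epsilon>0) 0
           (\<lambda>\<gamma>'. nth_deriv_within {3..q} 0
             (\<lambda>p'. nth_deriv_within {0..<\<epsilon>0} 1 (\<lambda>a'. u a' \<gamma>' p' x) a) p) \<gamma>\<bar> \<le> C"
    by (metis order_refl)
  have C: "\<bar>vector_derivative (\<lambda>a'. u a' \<gamma> p x) (at a within {0..<\<epsilon>0})\<bar> \<le> C"
    if "(a, \<gamma>, p) \<in> S3" for a \<gamma> p x
  proof -
    have par: "a \<in> {0..<\<epsilon>0}" "\<gamma> \<in> gamma_range \<epsilon>0" "p \<in> {3..q}" using that by auto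
    have "1 + max x 0 \<noteq> 0" by (simp add: max_def)
    then show ?thesis using bound[rule_format, OF par, of x] by (simp add: nth_deriv_within_def)
  qed
  have "C \<ge> 0" using C[of 0 "-1/2" 3 0] \<epsilon>0 q by (auto simp: gamma_range_def intro: order_trans[OF abs_ge_zero])
  moreover have "\<bar>u a \<gamma> p x - Q p x\<bar> \<le> C * a" if S3: "(a, \<gamma>, p) \<in> S3" for a \<gamma> p x
  proof -
    have par: "a \<in> {0..<\<epsilon>0}" "\<gamma> \<in> gamma_range \<epsilon>0" "p \<in> {3..q}" using S3 by auto
    have "norm (u a \<gamma> p x - u 0 \<gamma> p x) \<le> C * norm (a - 0)"
    proof (rule field_differentiable_bound[where S = "{0..<\<epsilon>0}"])
      fix t assume t: "t \<in> {0..<\<epsilon>0}"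
      have "((\<lambda>t. U 0 (t, \<gamma>, p, x)) has_derivative (\<lambda>h. frechet_derivative (U 0) (at (t, \<gamma>, p, x) within S4) (h, 0, 0, 0)))
          (at t within {0..<\<epsilon>0})"
        by (rule has_derivative_in_compose2[OF smooth_on_has_derivative[OF smooth_on_U]])
           (use par t in \<open>auto intro!: derivative_eq_intros simp: zero_prod_def\<close>)
      then have "(\<lambda>t. u t \<gamma> p x) differentiable (at t within {0..<\<epsilon>0})"
        unfolding U_0 differentiable_def by blast
      then show "((\<lambda>t. u t \<gamma> p x) has_field_derivative vector_derivative (\<lambda>t. u t \<gamma> p x) (at t within {0..<\<epsilon>0}))
          (at t within {0..<\<epsilon>0})"
        unfolding vector_derivative_works has_real_derivative_iff_has_vector_derivative .
      show "norm (vector_derivative (\<lambda>t. u t \<gamma> p x) (at t within {0..<\<epsilon>0})) \<le> C"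
        using C[of t \<gamma> p x] par t by simp
    qed (use par \<epsilon>0 in auto)
    moreover have "u 0 \<gamma> p x = Q p x" using family par unfolding profile_family_def by blast
    ultimately show ?thesis using par by simp
  qed
  ultimately show thesis using that by blast
qed

lemma F_first_order:
  assumes "\<gamma> \<in> gamma_range \<epsilon>0" "p \<in> {3..q}"
  obtains K where "\<And>a. a \<in> {0..<\<epsilon>0} \<Longrightarrow>
    \<bar>F (a, \<gamma>, p) * (\<integral>x. (Q_deriv p x)\<^sup>2 \<partial>lborel) - a * (\<gamma> + 1/2) * (\<integral>x. (Q p x)\<^sup>2 \<partial>lborel)\<bar> \<le> K * a\<^sup>2"
proof -
  obtain C where C: "C \<ge> 0" "\<And>a \<gamma> p x. (a, \<gamma>, p) \<in> S3 \<Longrightarrow> \<bar>u a \<gamma> p x - Q p x\<bar> \<le> C * a"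
    using close_to_soliton by blast
  have p: "p \<ge> 1" using assms by simp
  from soliton_projection[OF p C(1), of \<epsilon>0 \<gamma>] obtain K where
    K: "\<And>a u u1 u2 u3 F. 0 \<le> a \<Longrightarrow> a \<le> \<epsilon>0 \<Longrightarrow>
     (\<And>x. (u has_real_derivative u1 x) (at x)) \<Longrightarrow>
     (\<And>x. (u1 has_real_derivative u2 x) (at x)) \<Longrightarrow>
     (\<And>x. (u2 has_real_derivative u3 x) (at x)) \<Longrightarrow>
     (\<And>x. 0 < u x) \<Longrightarrow> (\<And>x. \<bar>u x - Q p x\<bar> \<le> C * a) \<Longrightarrow>
     (\<And>x. a * ((1 + \<gamma>) * u x + x * u1 x) - u3 x + u1 x - (p + 1) * u x powr p * u1 x
         + F * (Q p x - Q p x powr p * Q p x) = 0) \<Longrightarrow>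
     \<bar>F * (\<integral>x. (Q_deriv p x)\<^sup>2 \<partial>lborel) - a * (\<gamma> + 1/2) * (\<integral>x. (Q p x)\<^sup>2 \<partial>lborel)\<bar> \<le> K * a\<^sup>2"
    by blast
  show thesis
  proof (rule that[of K])
    fix a assume a: "a \<in> {0..<\<epsilon>0}"
    note par = a assms
    show "\<bar>F (a, \<gamma>, p) * (\<integral>x. (Q_deriv p x)\<^sup>2 \<partial>lborel) - a * (\<gamma> + 1/2) * (\<integral>x. (Q p x)\<^sup>2 \<partial>lborel)\<bar> \<le> K * a\<^sup>2"
    proof (rule K)
      show "((\<lambda>x. U 0 (a, \<gamma>, p, x)) has_real_derivative U 1 (a, \<gamma>, p, x)) (at x)"
        "((\<lambda>x. U 1 (a, \<gamma>, p, x)) has_real_derivative U 2 (a, \<gamma>, p, x)) (at x)"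
        "((\<lambda>x. U 2 (a, \<gamma>, p, x)) has_real_derivative U 3 (a, \<gamma>, p, x)) (at x)" for x
        using has_derivative_U[OF par, of 0 x] has_derivative_U[OF par, of 1 x] has_derivative_U[OF par, of 2 x]
        by (simp_all add: numeral_2_eq_2 numeral_3_eq_3)
      show "a * ((1 + \<gamma>) * U 0 (a, \<gamma>, p, x) + x * U 1 (a, \<gamma>, p, x)) - U 3 (a, \<gamma>, p, x) + U 1 (a, \<gamma>, p, x)
          - (p + 1) * U 0 (a, \<gamma>, p, x) powr p * U 1 (a, \<gamma>, p, x)
          + F (a, \<gamma>, p) * (Q p x - Q p x powr p * Q p x) = 0" for x
        using profile_equation[of a \<gamma> p x] par by (simp add: profile_op_eq)
    qed (use a u_pos[OF par] C(2)[of a \<gamma> p] par in \<open>auto simp: U_0\<close>)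
  qed
qed

lemma \<Phi>_face: "\<gamma> \<in> gamma_range \<epsilon>0 \<Longrightarrow> p \<in> {3..q} \<Longrightarrow> \<Phi> (0, \<gamma>, p) = 0"
proof -
  assume *: "\<gamma> \<in> gamma_range \<epsilon>0" "p \<in> {3..q}"
  obtain K where "\<And>a. a \<in> {0..<\<epsilon>0} \<Longrightarrow> \<bar>F (a, \<gamma>, p) * (\<integral>x. (Q_deriv p x)\<^sup>2 \<partial>lborel) -
      a * (\<gamma> + 1/2) * (\<integral>x. (Q p x)\<^sup>2 \<partial>lborel)\<bar> \<le> K * a\<^sup>2"
    using F_first_order[OF *] by blast
  from this[of 0] have "F (0, \<gamma>, p) = 0" using \<epsilon>0 soliton_norms_pos(2)[of p] * by simp
  then show ?thesis using \<Phi>_eq_F[of 0 \<gamma> p] * \<epsilon>0 by simp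
qed

text \<open>
  By the first-order expansion of \<open>F\<close> this is the \<open>\<gamma>\<close>-derivative of \<open>\<Phi> / a\<close> in the limit \<open>a = 0\<close>.
\<close>

definition \<kappa> :: "real \<Rightarrow> real" where
  "\<kappa> p = p / 2 * Q p 0 * (\<integral>x. (Q p x)\<^sup>2 \<partial>lborel) / (\<integral>x. (Q_deriv p x)\<^sup>2 \<partial>lborel)"

lemma \<kappa>_pos: "p > 0 \<Longrightarrow> \<kappa> p > 0"
  unfolding \<kappa>_def using soliton_norms_pos[of p] Q_pos[of p 0] by simp

lemma reduced_function:
  obtains G where "smooth_on S3 G"
    and "\<And>a \<gamma> p. (a, \<gamma>, p) \<in> S3 \<Longrightarrow> \<Phi> (a, \<gamma>, p) = a * G (a, \<gamma>, p)"
    and "\<And>\<gamma> p. \<gamma> \<in> gamma_range \<epsilon>0 \<Longrightarrow> p \<in> {3..q} \<Longrightarrow> G (0, \<gamma>, p) = \<kappa> p * (\<gamma> + 1/2)"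
proof -
  have "convex (gamma_range \<epsilon>0 \<times> {3..q})"
    unfolding gamma_range_eq by (intro convex_Times convex_real_interval)
  moreover have "\<And>z. z \<in> gamma_range \<epsilon>0 \<times> {3..q} \<Longrightarrow> \<Phi> (0, z) = 0" using \<Phi>_face by auto
  ultimately obtain G where G: "smooth_on S3 G"
    and div: "\<And>a z. a \<in> {0..<\<epsilon>0} \<Longrightarrow> z \<in> gamma_range \<epsilon>0 \<times> {3..q} \<Longrightarrow> \<Phi> (a, z) = a * G (a, z)"
    using smooth_on_divide_boundary_coordinate[OF \<epsilon>0 _ coordinate_perfect_Times[OF perfect_factors(2,3)] smooth_on_\<Phi>]
    by blast
  have "G (0, \<gamma>, p) = \<kappa> p * (\<gamma> + 1/2)" if par: "\<gamma> \<in> gamma_range \<epsilon>0" "p \<in> {3..q}" for \<gamma> p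
  proof -
    define I1 where "I1 = (\<integral>x. (Q_deriv p x)\<^sup>2 \<partial>lborel)"
    define I2 where "I2 = (\<integral>x. (Q p x)\<^sup>2 \<partial>lborel)"
    define c where "c = p / 2 * Q p 0"
    have c: "c > 0" "I1 > 0" using par Q_pos[of p 0] soliton_norms_pos[of p] by (auto simp: c_def I1_def)
    obtain K where K: "\<And>a. a \<in> {0..<\<epsilon>0} \<Longrightarrow> \<bar>F (a, \<gamma>, p) * I1 - a * (\<gamma> + 1/2) * I2\<bar> \<le> K * a\<^sup>2"
      using F_first_order[OF par] unfolding I1_def I2_def by blast
    have bound: "\<bar>G (a, \<gamma>, p) * I1 - c * (\<gamma> + 1/2) * I2\<bar> \<le> c * K * a" if a: "a \<in> {0<..<\<epsilon>0}" for a
    proof -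
      have aG: "a * G (a, \<gamma>, p) = F (a, \<gamma>, p) * c"
        using div[of a "(\<gamma>, p)"] \<Phi>_eq_F[of a \<gamma> p] a par by (simp add: c_def)
      have "a * (G (a, \<gamma>, p) * I1 - c * (\<gamma> + 1/2) * I2) = c * (F (a, \<gamma>, p) * I1 - a * (\<gamma> + 1/2) * I2)"
        using aG by (simp add: algebra_simps)
      then have "a * \<bar>G (a, \<gamma>, p) * I1 - c * (\<gamma> + 1/2) * I2\<bar> = c * \<bar>F (a, \<gamma>, p) * I1 - a * (\<gamma> + 1/2) * I2\<bar>"
        using a c by (metis abs_mult abs_of_pos greaterThanLessThan_iff)
      also have "\<dots> \<le> c * (K * a\<^sup>2)" using K[of a] a c by (intro mult_left_mono) auto
      finally have "a * \<bar>G (a, \<gamma>, p) * I1 - c * (\<gamma> + 1/2) * I2\<bar> \<le> a * (c * K * a)"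
        by (simp add: power2_eq_square mult_ac)
      then show ?thesis using a by simp
    qed
    have "continuous_on {0..<\<epsilon>0} (\<lambda>a. G (a, \<gamma>, p))"
      by (rule continuous_on_compose2[OF smooth_on_continuous[OF G]])
         (use par in \<open>auto intro!: continuous_intros\<close>)
    then have "((\<lambda>a. G (a, \<gamma>, p)) \<longlongrightarrow> G (0, \<gamma>, p)) (at 0 within {0..<\<epsilon>0})"
      using \<epsilon>0 by (auto simp: continuous_on)
    then have "((\<lambda>a. G (a, \<gamma>, p)) \<longlongrightarrow> G (0, \<gamma>, p)) (at 0 within {0..\<epsilon>0/2})"
      by (rule tendsto_within_subset) (use \<epsilon>0 in auto)
    then have "((\<lambda>a. G (a, \<gamma>, p) * I1 - c * (\<gamma> + 1/2) * I2) \<longlongrightarrow> G (0, \<gamma>, p) * I1 - c * (\<gamma> + 1/2) * I2) (at_right 0)"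
      using at_within_Icc_at_right[of 0 "\<epsilon>0/2"] \<epsilon>0 by (auto intro!: tendsto_intros)
    moreover have "((\<lambda>a. G (a, \<gamma>, p) * I1 - c * (\<gamma> + 1/2) * I2) \<longlongrightarrow> 0) (at_right 0)"
    proof (rule Lim_null_comparison)
      show "\<forall>\<^sub>F a in at_right 0. norm (G (a, \<gamma>, p) * I1 - c * (\<gamma> + 1/2) * I2) \<le> c * K * a"
        using bound \<epsilon>0 unfolding eventually_at_right_field by (intro exI[of _ \<epsilon>0]) auto
      show "((\<lambda>a. c * K * a) \<longlongrightarrow> 0) (at_right 0)" by (auto intro!: tendsto_eq_intros)
    qed
    ultimately have "G (0, \<gamma>, p) * I1 - c * (\<gamma> + 1/2) * I2 = 0"
      using tendsto_unique trivial_limit_at_right_real by blast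
    then show ?thesis using c by (simp add: \<kappa>_def c_def I1_def I2_def field_simps)
  qed
  with G div show thesis using that by simp
qed

end

context profiles
begin

text \<open>
  The equation \<open>\<Phi> = 0\<close> says nothing at \<open>a = 0\<close>, but it does say \<open>G = 0\<close> for \<open>a > 0\<close>.
  A path of zeros over an interval of positive length therefore has \<open>G = 0\<close> at its starting point
  by continuity, which forces it to start at \<open>- 1/2\<close>; over the single point \<open>a = 0\<close> the starting
  value has to be given.
\<close>

lemma zero_branch:
  assumes e: "0 < e" "e \<le> \<epsilon>0"
  obtains \<epsilon> g where "0 < \<epsilon>" "\<epsilon> \<le> e" "smooth_on ({0..<\<epsilon>} \<times> {3..q}) g"
    and "\<And>a p. a \<in> {0..<\<epsilon>} \<Longrightarrow> p \<in> {3..q} \<Longrightarrow> g (a, p) \<in> gamma_range \<epsilon>0 \<and> \<Phi> (a, g (a, p), p) = 0"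
    and "\<And>p. p \<in> {3..q} \<Longrightarrow> g (0, p) = - 1/2"
    and "\<And>a c \<pi>. a \<in> {0..<\<epsilon>} \<Longrightarrow> continuous_on {0..a} c \<Longrightarrow> continuous_on {0..a} \<pi> \<Longrightarrow>
           (\<And>t. t \<in> {0..a} \<Longrightarrow> c t \<in> gamma_range \<epsilon>0 \<and> \<pi> t \<in> {3..q} \<and> \<Phi> (t, c t, \<pi> t) = 0) \<Longrightarrow>
           c 0 = - 1/2 \<or> a > 0 \<Longrightarrow> c a = g (a, \<pi> a)"
proof -
  obtain G where G: "smooth_on S3 G"
    and div: "\<And>a \<gamma> p. (a, \<gamma>, p) \<in> S3 \<Longrightarrow> \<Phi> (a, \<gamma>, p) = a * G (a, \<gamma>, p)"
    and face: "\<And>\<gamma> p. \<gamma> \<in> gamma_range \<epsilon>0 \<Longrightarrow> p \<in> {3..q} \<Longrightarrow> G (0, \<gamma>, p) = \<kappa> p * (\<gamma> + 1/2)"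
    using reduced_function by blast
  define H where "H x = G (fst (fst x), snd x, snd (fst x))" for x
  have H_simp: "H ((a, p), y) = G (a, y, p)" for a p y by (simp add: H_def)
  have in_range: "y \<in> gamma_range \<epsilon>0 \<longleftrightarrow> \<bar>y - (- 1/2)\<bar> < \<epsilon>0" for y by (simp add: gamma_range_def)
  have "smooth_on (({0..<e} \<times> {3..q}) \<times> {- 1/2 - \<epsilon>0<..<- 1/2 + \<epsilon>0}) H"
    unfolding H_def[abs_def]
  proof (rule smooth_on_compose_linear[OF G])
    show "(\<lambda>x. (fst (fst x), snd x, snd (fst x))) `
        (({0..<e} \<times> {3..q}) \<times> {- 1/2 - \<epsilon>0<..<- 1/2 + \<epsilon>0}) \<subseteq> S3"
      unfolding gamma_range_eq using e(2) by auto
  qed (auto intro!: bounded_linear_euclideanI)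
  moreover have "H ((0, p), y) = \<kappa> p * (y - (- 1/2))" if "p \<in> {3..q}" "\<bar>y - (- 1/2)\<bar> < \<epsilon>0" for p y
    using face[of y p] that in_range[of y] by (simp add: H_simp)
  moreover have "\<kappa> p > 0" if "p \<in> {3..q}" for p using \<kappa>_pos that by simp
  ultimately obtain \<epsilon> g where \<epsilon>: "0 < \<epsilon>" "\<epsilon> \<le> e" and smooth: "smooth_on ({0..<\<epsilon>} \<times> {3..q}) g"
    and g: "\<And>z. z \<in> {0..<\<epsilon>} \<times> {3..q} \<Longrightarrow> \<bar>g z - (- 1/2)\<bar> < \<epsilon>0 \<and> H (z, g z) = 0"
    and g0: "\<And>p. p \<in> {3..q} \<Longrightarrow> g (0, p) = - 1/2"
    and path: "\<And>a c \<pi>. a \<in> {0..<\<epsilon>} \<Longrightarrow> continuous_on {0..a} c \<Longrightarrow> c 0 = - 1/2 \<Longrightarrow>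
           (\<And>t. t \<in> {0<..a} \<Longrightarrow> \<pi> t \<in> {3..q} \<and> H ((t, \<pi> t), c t) = 0) \<Longrightarrow> \<pi> a \<in> {3..q} \<Longrightarrow> c a = g (a, \<pi> a)"
    using smooth_zero_branch[OF e(1) \<epsilon>0 compact_Icc perfect_factors(3), of "- 1/2" H \<kappa>] by blast
  show thesis
  proof (rule that[OF \<epsilon> smooth _ g0])
    show "g (a, p) \<in> gamma_range \<epsilon>0 \<and> \<Phi> (a, g (a, p), p) = 0" if "a \<in> {0..<\<epsilon>}" "p \<in> {3..q}" for a p
      using g[of "(a, p)"] that in_range div[of a "g (a, p)" p] \<epsilon> e by (auto simp: H_simp)
    fix a c \<pi>
    assume a: "a \<in> {0..<\<epsilon>}" and cont: "continuous_on {0..a} c" "continuous_on {0..a} \<pi>"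
      and zero: "\<And>t. t \<in> {0..a} \<Longrightarrow> c t \<in> gamma_range \<epsilon>0 \<and> \<pi> t \<in> {3..q} \<and> \<Phi> (t, c t, \<pi> t) = 0"
      and start: "c 0 = - 1/2 \<or> a > 0"
    have S3: "(t, c t, \<pi> t) \<in> S3" if "t \<in> {0..a}" for t
      using zero[OF that] that a \<epsilon> e by auto
    have Gzero: "G (t, c t, \<pi> t) = 0" if "t \<in> {0<..a}" for t
      using div[OF S3, of t] zero[of t] that by auto
    have "c 0 = - 1/2"
      using start
    proof
      assume "a > 0"
      have "continuous_on {0..a} (\<lambda>t. G (t, c t, \<pi> t))"
        by (rule continuous_on_compose2[OF smooth_on_continuous[OF G]])
           (use S3 in \<open>auto intro!: continuous_intros cont\<close>)
      then have "G (0, c 0, \<pi> 0) = 0"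
        using \<open>a > 0\<close> Gzero
        by (intro continuous_constant_on_closure[of "{0<..<a}" "\<lambda>t. G (t, c t, \<pi> t)" 0 0]) auto
      then have "\<kappa> (\<pi> 0) * (c 0 + 1/2) = 0" using face[of "c 0" "\<pi> 0"] zero[of 0] \<open>a > 0\<close> by simp
      then show ?thesis using \<kappa>_pos[of "\<pi> 0"] zero[of 0] \<open>a > 0\<close> by simp
    qed
    then show "c a = g (a, \<pi> a)"
      using a cont(1) Gzero zero by (intro path) (auto simp: H_simp)
  qed
qed

end

text \<open>
  The first-order expansion of a branch at the corner: it is constant in \<open>p\<close> on the face \<open>a = 0\<close>,
  so its derivative along the curve \<open>a \<mapsto> (a, P a)\<close> is its partial derivative in \<open>a\<close>.
\<close>

lemma branch_derivative_along_curve: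
  fixes g :: "real \<times> real \<Rightarrow> real"
  assumes \<epsilon>: "\<epsilon> > 0" and q: "q > 4" and g: "smooth_on ({0..<\<epsilon>} \<times> {3..q}) g"
    and face: "\<And>p. p \<in> {3..q} \<Longrightarrow> g (0, p) = - 1/2"
    and P: "P 0 = 4" "(P has_real_derivative m) (at 0 within {0..<\<epsilon>})" "\<And>a. a \<in> {0..<\<epsilon>} \<Longrightarrow> P a \<in> {3..q}"
    and curve: "\<And>a. a \<in> {0..<\<epsilon>} \<Longrightarrow> g (a, P a) = 2 / P a - 1"
  shows "((\<lambda>a. g (a, 4)) has_real_derivative - (1/8 * m)) (at 0 within {0..<\<epsilon>})"
proof -
  let ?Z = "{0..<\<epsilon>} \<times> {3..q}"
  define D where "D = frechet_derivative g (at (0, 4) within ?Z)"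
  note dg = smooth_on_has_derivative[OF g]
  have "linear D" unfolding D_def using dg[of "(0, 4)"] \<epsilon> q by (intro has_derivative_linear) auto
  have perf\<epsilon>: "coordinate_perfect {0..<\<epsilon>}"
    by (rule coordinate_perfect_interval[of _ 0 "\<epsilon> / 2"]) (use \<epsilon> in \<open>auto simp: is_interval_def\<close>)
  have perfq: "coordinate_perfect {3..q}"
    by (rule coordinate_perfect_interval[of _ 3 4]) (use q in \<open>auto simp: is_interval_def\<close>)
  have "((\<lambda>p. g (0, p)) has_derivative (\<lambda>h. D (0, h))) (at 4 within {3..q})"
    unfolding D_def by (rule has_derivative_in_compose2[OF dg]) (use \<epsilon> q in \<open>auto intro!: derivative_eq_intros\<close>)
  moreover have "((\<lambda>p. g (0, p)) has_derivative (\<lambda>h. 0)) (at 4 within {3..q})"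
    by (rule has_derivative_transform[OF _ _ has_derivative_const[of "- 1/2"]]) (use q face in auto)
  ultimately have "(\<lambda>h. D (0, h)) = (\<lambda>h. 0)"
    by (rule has_derivative_unique_coordinate_perfect[OF _ _ perfq]) (use q in auto)
  then have D0: "D (0, h) = 0" for h by metis
  have D_split: "D (h, k) = D (h, 0)" for h k
    using linear_add[OF \<open>linear D\<close>, of "(h, 0)" "(0, k)"] D0[of k] by simp
  have dP: "(P has_derivative (\<lambda>h. m * h)) (at 0 within {0..<\<epsilon>})"
    using P(2) by (simp add: has_field_derivative_def)
  have "((\<lambda>a. g (a, P a)) has_derivative (\<lambda>h. D (h, m * h))) (at 0 within {0..<\<epsilon>})"
    unfolding D_def P(1)[symmetric]
    by (rule has_derivative_in_compose2[OF dg]) (use \<epsilon> P in \<open>auto intro!: derivative_eq_intros dP\<close>)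
  moreover have "((\<lambda>a. g (a, P a)) has_derivative (\<lambda>h. - (1/8 * m) * h)) (at 0 within {0..<\<epsilon>})"
  proof (rule has_derivative_transform)
    have "((\<lambda>a. 2 / P a - 1) has_real_derivative - (1/8 * m)) (at 0 within {0..<\<epsilon>})"
      using P(1) by (auto intro!: derivative_eq_intros P(2))
    then show "((\<lambda>a. 2 / P a - 1) has_derivative (\<lambda>h. - (1/8 * m) * h)) (at 0 within {0..<\<epsilon>})"
      by (simp only: has_field_derivative_def)
  qed (use curve \<epsilon> in auto)
  ultimately have "(\<lambda>h. D (h, m * h)) = (\<lambda>h. - (1/8 * m) * h)"
    by (rule has_derivative_unique_coordinate_perfect[OF _ _ perf\<epsilon>]) (use \<epsilon> in auto)
  then have Dh: "(\<lambda>h. D (h, 0)) = (\<lambda>h. - (1/8 * m) * h)" by (simp only: D_split[of h "m * h" for h])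
  have "((\<lambda>a. g (a, 4)) has_derivative (\<lambda>h. D (h, 0))) (at 0 within {0..<\<epsilon>})"
    unfolding D_def by (rule has_derivative_in_compose2[OF dg]) (use \<epsilon> q in \<open>auto intro!: derivative_eq_intros\<close>)
  then show ?thesis unfolding Dh by (simp only: has_field_derivative_def)
qed

theorem theorem3:
  fixes q \<epsilon>0 a0 :: real
    and u :: "real \<Rightarrow> real \<Rightarrow> real \<Rightarrow> real \<Rightarrow> real"
    and P :: "real \<Rightarrow> real"
  assumes "q > 4"
    and "\<epsilon>0 > 0" and "unique_profile_family \<epsilon>0 q u"
    and "0 < a0" and "a0 \<le> \<epsilon>0" and "unique_exponent_curve \<epsilon>0 q u a0 P"
  shows "(\<exists>\<epsilon>>0. \<epsilon> \<le> a0 \<and>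
           (\<exists>\<gamma>. gamma_branch \<epsilon>0 q u P \<epsilon> \<gamma> \<and>
                (\<forall>\<gamma>'. gamma_branch \<epsilon>0 q u P \<epsilon> \<gamma>' \<longrightarrow>
                   (\<forall>a\<in>{0..<\<epsilon>}. \<forall>p\<in>{3..q}. \<gamma>' a p = \<gamma> a p)) \<and>
                (\<forall>p\<in>{3..q}. \<forall>x. u 0 (\<gamma> 0 p) p x = Q p x))) \<and>
         (L1_norm (Q 4))\<^sup>2 / (L2_norm (Q 4))\<^sup>2 = Gamma (1/4) ^ 4 / (4 * pi\<^sup>2)"
proof (intro conjI)
  interpret profiles q \<epsilon>0 u
    using assms(1-3) unfolding unique_profile_family_def by unfold_locales auto
  define m where "m = (L1_norm (Q 4))\<^sup>2 / (L2_norm (Q 4))\<^sup>2"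
  have "exponent_curve \<epsilon>0 q u a0 P" using assms(6) by (simp add: unique_exponent_curve_def)
  then have P: "smooth_on {0..<a0} P" "P 0 = 4" "(P has_real_derivative m) (at 0 within {0..<a0})"
    and P_range: "\<And>a. a \<in> {0..<a0} \<Longrightarrow> P a \<in> {3..q} \<and> 2 / P a - 1 \<in> gamma_range \<epsilon>0"
    and P_solves: "\<And>a x. a \<in> {0..<a0} \<Longrightarrow> profile_op a (2 / P a) (P a) (u a (2 / P a - 1) (P a)) x = 0"
    unfolding exponent_curve_def m_def by blast+
  obtain \<epsilon> g where \<epsilon>: "0 < \<epsilon>" "\<epsilon> \<le> a0" and smooth: "smooth_on ({0..<\<epsilon>} \<times> {3..q}) g"
    and g: "\<And>a p. a \<in> {0..<\<epsilon>} \<Longrightarrow> p \<in> {3..q} \<Longrightarrow> g (a, p) \<in> gamma_range \<epsilon>0 \<and> \<Phi> (a, g (a, p), p) = 0"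
    and g0: "\<And>p. p \<in> {3..q} \<Longrightarrow> g (0, p) = - 1/2"
    and path: "\<And>a c \<pi>. a \<in> {0..<\<epsilon>} \<Longrightarrow> continuous_on {0..a} c \<Longrightarrow> continuous_on {0..a} \<pi> \<Longrightarrow>
           (\<And>t. t \<in> {0..a} \<Longrightarrow> c t \<in> gamma_range \<epsilon>0 \<and> \<pi> t \<in> {3..q} \<and> \<Phi> (t, c t, \<pi> t) = 0) \<Longrightarrow>
           c 0 = - 1/2 \<or> a > 0 \<Longrightarrow> c a = g (a, \<pi> a)"
    using zero_branch[OF assms(4,5)] by blast
  have S3: "(a, \<gamma>, p) \<in> S3" if "a \<in> {0..<\<epsilon>}" "\<gamma> \<in> gamma_range \<epsilon>0" "p \<in> {3..q}" for a \<gamma> p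
    using that \<epsilon> assms(5) by auto
  have divergence: "a * ((1 + \<gamma>) * u a \<gamma> p x + x * deriv (u a \<gamma> p) x)
          - deriv (\<lambda>y. (deriv ^^ 2) (u a \<gamma> p) y - u a \<gamma> p y + \<bar>u a \<gamma> p y\<bar> powr p * u a \<gamma> p y) x
       = profile_op a (1 + \<gamma>) p (u a \<gamma> p) x"
    if "a \<in> {0..<\<epsilon>}" "\<gamma> \<in> gamma_range \<epsilon>0" "p \<in> {3..q}" for a \<gamma> p x
    using divergence_form_eq[of a \<gamma> p "1 + \<gamma>" x] S3[OF that] by auto
  have contP: "continuous_on {0..<a0} P" using P(1) by (rule smooth_on_continuous)
  have on_curve: "g (a, P a) = 2 / P a - 1" if a: "a \<in> {0..<\<epsilon>}" for a
  proof (rule path[OF a, of "\<lambda>t. 2 / P t - 1" P, symmetric])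
    have sub: "{0..a} \<subseteq> {0..<a0}" using a \<epsilon> by auto
    show "continuous_on {0..a} P" using contP sub by (rule continuous_on_subset)
    then show "continuous_on {0..a} (\<lambda>t. 2 / P t - 1)"
      using P_range sub by (intro continuous_intros) force+
    show "2 / P t - 1 \<in> gamma_range \<epsilon>0 \<and> P t \<in> {3..q} \<and> \<Phi> (t, 2 / P t - 1, P t) = 0"
      if "t \<in> {0..a}" for t
      using P_range[of t] P_solves[of t 0] that sub by (auto simp: \<Phi>_def)
  qed (simp add: P(2))
  have unique: "\<gamma>' a p = g (a, p)"
    if branch: "gamma_branch \<epsilon>0 q u P \<epsilon> \<gamma>'" and a: "a \<in> {0..<\<epsilon>}" and p: "p \<in> {3..q}" for \<gamma>' a p
  proof -
    have sm: "smooth_on ({0..<\<epsilon>} \<times> {3..q}) (\<lambda>(a, p). \<gamma>' a p)"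
      and range: "\<And>a p. a \<in> {0..<\<epsilon>} \<Longrightarrow> p \<in> {3..q} \<Longrightarrow> \<gamma>' a p \<in> gamma_range \<epsilon>0"
      and solves: "\<And>a p x. a \<in> {0..<\<epsilon>} \<Longrightarrow> p \<in> {3..q} \<Longrightarrow>
        a * ((1 + \<gamma>' a p) * u a (\<gamma>' a p) p x + x * deriv (u a (\<gamma>' a p) p) x)
          - deriv (\<lambda>y. (deriv ^^ 2) (u a (\<gamma>' a p) p) y - u a (\<gamma>' a p) p y
                        + \<bar>u a (\<gamma>' a p) p y\<bar> powr p * u a (\<gamma>' a p) p y) x = 0"
      using branch unfolding gamma_branch_def by blast+
    have zero: "\<Phi> (t, \<gamma>' t p, p) = 0" if t: "t \<in> {0..<\<epsilon>}" for t
      using solves[OF t p, of 0] divergence[OF t range[OF t p] p, of 0] by (simp add: \<Phi>_def)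
    have cont: "continuous_on {0..b} (\<lambda>t. \<gamma>' t p)" if "b \<in> {0..<\<epsilon>}" for b
    proof -
      have "continuous_on {0..b} (\<lambda>t. case (t, p) of (a, p) \<Rightarrow> \<gamma>' a p)"
        by (rule continuous_on_compose2[OF smooth_on_continuous[OF sm]])
           (use that p in \<open>auto intro!: continuous_intros\<close>)
      then show ?thesis by simp
    qed
    \<comment> \<open>For fixed \<open>p\<close> the competing branch is a path of zeros; its value at \<open>a = 0\<close> follows by continuity.\<close>
    have pos: "\<gamma>' b p = g (b, p)" if b: "b \<in> {0<..<\<epsilon>}" for b
      using b p zero range by (intro path[of b "\<lambda>t. \<gamma>' t p" "\<lambda>_. p"] cont) auto
    show ?thesis
    proof (cases "a = 0")
      case True
      have "continuous_on {0..\<epsilon>/2} (\<lambda>t. g (t, p))"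
        by (rule continuous_on_compose2[OF smooth_on_continuous[OF smooth]])
           (use p \<epsilon> in \<open>auto intro!: continuous_intros\<close>)
      then have "continuous_on {0..\<epsilon>/2} (\<lambda>t. \<gamma>' t p - g (t, p))"
        using cont[of "\<epsilon>/2"] \<epsilon> by (auto intro!: continuous_intros)
      then have "\<gamma>' 0 p - g (0, p) = 0"
        using \<epsilon> pos
        by (intro continuous_constant_on_closure[of "{0<..<\<epsilon>/2}" "\<lambda>t. \<gamma>' t p - g (t, p)" 0 0]) auto
      then show ?thesis using True by simp
    next
      case False
      then show ?thesis using pos[of a] a by simp
    qed
  qed
  define \<gamma> where "\<gamma> a p = g (a, p)" for a p
  have "gamma_branch \<epsilon>0 q u P \<epsilon> \<gamma>"
    unfolding gamma_branch_def
  proof (intro conjI ballI allI)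
    show "smooth_on ({0..<\<epsilon>} \<times> {3..q}) (\<lambda>(a, p). \<gamma> a p)" using smooth by (simp add: \<gamma>_def)
    show "((\<lambda>a. \<gamma> a 4) has_real_derivative - (1/8 * ((L1_norm (Q 4))\<^sup>2 / (L2_norm (Q 4))\<^sup>2))) (at 0 within {0..<\<epsilon>})"
      unfolding \<gamma>_def m_def[symmetric]
    proof (rule branch_derivative_along_curve[OF \<epsilon>(1) assms(1) smooth g0 P(2) _ _ on_curve])
      show "(P has_real_derivative m) (at 0 within {0..<\<epsilon>})"
        using P(3) \<epsilon> by (elim DERIV_subset) auto
    qed (use P_range \<epsilon> in auto)
    show "((\<lambda>p. \<gamma> 0 p) has_real_derivative 0) (at 4)"
      by (rule has_field_derivative_transform_within_open[OF DERIV_const[of "- 1/2"], where S = "{3<..<q}"])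
         (use assms(1) g0 in \<open>auto simp: \<gamma>_def\<close>)
    show "a * ((1 + \<gamma> a p) * u a (\<gamma> a p) p x + x * deriv (u a (\<gamma> a p) p) x)
          - deriv (\<lambda>y. (deriv ^^ 2) (u a (\<gamma> a p) p) y - u a (\<gamma> a p) p y
                        + \<bar>u a (\<gamma> a p) p y\<bar> powr p * u a (\<gamma> a p) p y) x = 0"
      if "a \<in> {0..<\<epsilon>}" "p \<in> {3..q}" for a p x
    proof -
      have g_ap: "g (a, p) \<in> gamma_range \<epsilon>0" "\<Phi> (a, g (a, p), p) = 0" using g[OF that] by auto
      then have "profile_op a (1 + g (a, p)) p (u a (g (a, p)) p) x = 0"
        using \<Phi>_eq_0_iff[OF S3[OF that(1) g_ap(1) that(2)]] by blast
      then show ?thesis unfolding \<gamma>_def divergence[OF that(1) g_ap(1) that(2)] .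
    qed
    show "in_L2 (deriv (u a (\<gamma> a p) p))" if "a \<in> {0..<\<epsilon>}" "p \<in> {3..q}" for a p
    proof -
      have "\<forall>a\<in>{0..<\<epsilon>0}. \<forall>\<gamma>\<in>gamma_range \<epsilon>0. \<forall>p\<in>{3..q}. (\<forall>x. u a \<gamma> p x > 0) \<and> in_L2 (deriv (u a \<gamma> p))"
        using family unfolding profile_family_def by (elim conjE)
      moreover have "a \<in> {0..<\<epsilon>0}" "g (a, p) \<in> gamma_range \<epsilon>0" using g[OF that] that(1) \<epsilon> assms(5) by auto
      ultimately show ?thesis using that(2) unfolding \<gamma>_def by blast
    qed
    show "\<exists>c. \<forall>a\<in>{0..<\<epsilon>}. \<forall>p\<in>{3..q}. \<forall>x. (1 + a * \<bar>x\<bar>) powr (1 + \<gamma> a p) * \<bar>u a (\<gamma> a p) p x\<bar> \<le> c"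
    proof -
      have "\<exists>C. \<forall>a\<in>{0..<\<epsilon>0}. \<forall>\<gamma>\<in>gamma_range \<epsilon>0. \<forall>p\<in>{3..q}. \<forall>x.
          (1 + a * \<bar>x\<bar>) powr (1 + \<gamma>) * \<bar>u a \<gamma> p x\<bar> \<le> C"
        using family unfolding profile_family_def by (elim conjE)
      then obtain C where C: "\<forall>a\<in>{0..<\<epsilon>0}. \<forall>\<gamma>\<in>gamma_range \<epsilon>0. \<forall>p\<in>{3..q}. \<forall>x.
          (1 + a * \<bar>x\<bar>) powr (1 + \<gamma>) * \<bar>u a \<gamma> p x\<bar> \<le> C" by blast
      show ?thesis
        using g \<epsilon> assms(5) by (intro exI[of _ C] ballI allI C[rule_format]) (auto simp: \<gamma>_def)
    qed
  qed (use \<epsilon> assms(1) g g0 on_curve in \<open>auto simp: \<gamma>_def\<close>)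
  moreover have "u 0 (\<gamma> 0 p) p x = Q p x" if "p \<in> {3..q}" for p x
  proof -
    have "\<forall>\<gamma>\<in>gamma_range \<epsilon>0. \<forall>p\<in>{3..q}. \<forall>x. u 0 \<gamma> p x = Q p x"
      using family unfolding profile_family_def by (elim conjE)
    moreover have "g (0, p) \<in> gamma_range \<epsilon>0" using g[of 0 p] that \<epsilon> by simp
    ultimately show ?thesis using that unfolding \<gamma>_def by blast
  qed
  ultimately show "\<exists>\<epsilon>>0. \<epsilon> \<le> a0 \<and>
           (\<exists>\<gamma>. gamma_branch \<epsilon>0 q u P \<epsilon> \<gamma> \<and>
                (\<forall>\<gamma>'. gamma_branch \<epsilon>0 q u P \<epsilon> \<gamma>' \<longrightarrow>
                   (\<forall>a\<in>{0..<\<epsilon>}. \<forall>p\<in>{3..q}. \<gamma>' a p = \<gamma> a p)) \<and>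
                (\<forall>p\<in>{3..q}. \<forall>x. u 0 (\<gamma> 0 p) p x = Q p x))"
    using \<epsilon> unique[folded \<gamma>_def] by (intro exI[of _ \<epsilon>] conjI exI[of _ \<gamma>] allI impI ballI)
  show "(L1_norm (Q 4))\<^sup>2 / (L2_norm (Q 4))\<^sup>2 = Gamma (1/4) ^ 4 / (4 * pi\<^sup>2)"
    by (rule L1_norm_Q4_sq_div_L2_norm_Q4_sq)
qed

end
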